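(* For all finite sets $\Gamma_1,\Gamma_2$ of formulas and finite multisets $\Delta_1,\Delta_2$ of formulas: $(\Gamma_1;\Delta_1)\preceq_l(\Gamma_2;\Delta_2)$ if and only if $(\Gamma_1;\Delta_1)\preceq_s(\Gamma_2;\Delta_2)$.
   Context: Formulas: $A,B,C ::= a \mid \mathbf{1} \mid A\otimes B \mid \top \mid A \,\&\, B \mid a \multimap B \mid\ !A$, with $a$ ranging over atomic formulas. Contexts $\Gamma,\Delta$ are finite multisets of formulas; "$\Delta_1,\Delta_2$" is multiset union, "$\cdot$" the empty context. Sequents $\Gamma;\Delta\vdash A$ are derivable by the rules: (init) $\Gamma;a\vdash a$. (clone) from $\Gamma,A;\Delta,A\vdash C$ infer $\Gamma,A;\Delta\vdash C$. ($\otimes$R) from $\Gamma;\Delta_1\vdash A$ and $\Gamma;\Delta_2\vdash B$ infer $\Gamma;\Delta_1,\Delta_2\vdash A\otimes B$. ($\otimes$L) from $\Gamma;\Delta,A,B\vdash C$ infer $\Gamma;\Delta,A\otimes B\vdash C$. ($\mathbf 1$R) $\Gamma;\cdot\vdash\mathbf 1$. ($\mathbf 1$L) from $\Gamma;\Delta\vdash C$ infer $\Gamma;\Delta,\mathbf 1\vdash C$. ($\&$R) from $\Gamma;\Delta\vdash A$ and $\Gamma;\Delta\vdash B$ infer $\Gamma;\Delta\vdash A\&B$. ($\&$L$_i$, $i=1,2$) from $\Gamma;\Delta,A_i\vdash C$ infer $\Gamma;\Delta,A_1\&A_2\vdash C$. ($\top$R) $\Gamma;\Delta\vdash\top$ (no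 left rule for $\top$). ($\multimap$R) from $\Gamma;\Delta,a\vdash B$ infer $\Gamma;\Delta\vdash a\multimap B$. ($\multimap$L) from $\Gamma;\Delta_1\vdash a$ and $\Gamma;\Delta_2,B\vdash C$ infer $\Gamma;\Delta_1,\Delta_2,a\multimap B\vdash C$. (!R) from $\Gamma;\cdot\vdash A$ infer $\Gamma;\cdot\vdash\,!A$. (!L) from $\Gamma,A;\Delta\vdash C$ infer $\Gamma;\Delta,!A\vdash C$. Logical preorder: $(\Gamma_1;\Delta_1)\preceq_l(\Gamma_2;\Delta_2)$ iff for all contexts $\Gamma',\Delta'$ and all formulas $C$, derivability of $\Gamma',\Gamma_1;\Delta',\Delta_1\vdash C$ implies derivability of $\Gamma',\Gamma_2;\Delta',\Delta_2\vdash C$. States are pairs $(\Gamma;\Delta)$ modulo structural congruence $\equiv$: $\Delta$ is a multiset and $\Gamma$ a set ($(\Gamma,A,A;\Delta)\equiv(\Gamma,A;\Delta)$); congruent states are identified. Composition: $((\Gamma_1;\Delta_1),(\Gamma_2;\Delta_2)) := (\Gamma_1,\Gamma_2;\Delta_1,\Delta_2)$. Labelled transitions with labels $\tau$, $!a$, $?a$ ($a$ atomic) are generated by: $(\Gamma;\Delta,a)\xrightarrow{!a}(\Gamma;\Delta)$; $(\Gamma;\Delta,a\multimap B)\xrightarrow{?a}(\Gamma;\Delta,B)$; if $S_1\xrightarrow{!a}S_1'$ and $S_2\xrightarrow{?a}S_2'$ then $(S_1,S_2)\xrightarrow{\tau}(S_1',S_2')$; $(\Gamma;\Delta,A\otimes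 B)\xrightarrow{\tau}(\Gamma;\Delta,A,B)$; $(\Gamma;\Delta,\mathbf 1)\xrightarrow{\tau}(\Gamma;\Delta)$; $(\Gamma;\Delta,A_1\&A_2)\xrightarrow{\tau}(\Gamma;\Delta,A_i)$; $(\Gamma;\Delta,!A)\xrightarrow{\tau}(\Gamma,A;\Delta)$; $(\Gamma,A;\Delta)\xrightarrow{\tau}(\Gamma,A;\Delta,A)$ (no rule for $\top$). $\alpha$ ranges over $\tau$ and $!a$. $\overset{\tau}{\Longrightarrow}$ is the reflexive transitive closure of $\xrightarrow{\tau}$; for $\beta\ne\tau$, $\overset{\beta}{\Longrightarrow}$ is $\overset{\tau}{\Longrightarrow}\xrightarrow{\beta}\overset{\tau}{\Longrightarrow}$. A relation $\mathcal R$ on states is a simulation if $(\Gamma_1;\Delta_1)\mathcal R(\Gamma_2;\Delta_2)$ implies: (1) if $(\Gamma_1;\Delta_1)\equiv(\Gamma_1';\cdot)$ then $(\Gamma_2;\Delta_2)\overset{\tau}{\Longrightarrow}(\Gamma_2';\cdot)$ with $(\Gamma_1';\cdot)\mathcal R(\Gamma_2';\cdot)$; (2) if $(\Gamma_1;\Delta_1)\equiv((\Gamma_1';\Delta_1'),(\Gamma_1'';\Delta_1''))$ then $(\Gamma_2;\Delta_2)\overset{\tau}{\Longrightarrow}((\Gamma_2';\Delta_2'),(\Gamma_2'';\Delta_2''))$ with $(\Gamma_1';\Delta_1')\mathcal R(\Gamma_2';\Delta_2')$ and $(\Gamma_1'';\Delta_1'')\mathcal R(\Gamma_2'';\Delta_2'')$;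 (3) if $(\Gamma_1;\Delta_1)\xrightarrow{\alpha}(\Gamma_1';\Delta_1')$ then $(\Gamma_2;\Delta_2)\overset{\alpha}{\Longrightarrow}(\Gamma_2';\Delta_2')$ with $(\Gamma_1';\Delta_1')\mathcal R(\Gamma_2';\Delta_2')$; (4) if $(\Gamma_1;\Delta_1)\xrightarrow{?a}(\Gamma_1';\Delta_1')$ then $(\Gamma_2;\Delta_2,a)\overset{\tau}{\Longrightarrow}(\Gamma_2';\Delta_2')$ with $(\Gamma_1';\Delta_1')\mathcal R(\Gamma_2';\Delta_2')$. $S_1\preceq_s S_2$ iff some simulation relates $S_1$ to $S_2$. *)

theory Defs
  imports "HOL-Library.Multiset" "HOL-Library.FSet"
begin

datatype 'a form =
    Atom 'a
  | One
  | Tensor "'a form" "'a form"  (infixr \<open>\<otimes>\<close> 72)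
  | Top
  | With "'a form" "'a form"  (infixr \<open>&&\<close> 71)
  | Lolli 'a "'a form"  (infixr \<open>\<multimap>\<close> 70)
  | Bang "'a form"

inductive derivable :: "'a form multiset \<Rightarrow> 'a form multiset \<Rightarrow> 'a form \<Rightarrow> bool" where
  init: "derivable \<Gamma> {#Atom a#} (Atom a)"
| clone: "derivable (\<Gamma> + {#A#}) (\<Delta> + {#A#}) C \<Longrightarrow> derivable (\<Gamma> + {#A#}) \<Delta> C"
| tensorR: "derivable \<Gamma> \<Delta>\<^sub>1 A \<Longrightarrow> derivable \<Gamma> \<Delta>\<^sub>2 B \<Longrightarrow> derivable \<Gamma> (\<Delta>\<^sub>1 + \<Delta>\<^sub>2) (A \<otimes> B)"
| tensorL: "derivable \<Gamma> (\<Delta> + {#A, B#}) C \<Longrightarrow> derivable \<Gamma> (\<Delta> + {#A \<otimes> B#}) C"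
| oneR: "derivable \<Gamma> {#} One"
| oneL: "derivable \<Gamma> \<Delta> C \<Longrightarrow> derivable \<Gamma> (\<Delta> + {#One#}) C"
| withR: "derivable \<Gamma> \<Delta> A \<Longrightarrow> derivable \<Gamma> \<Delta> B \<Longrightarrow> derivable \<Gamma> \<Delta> (A && B)"
| withL1: "derivable \<Gamma> (\<Delta> + {#A#}) C \<Longrightarrow> derivable \<Gamma> (\<Delta> + {#A && B#}) C"
| withL2: "derivable \<Gamma> (\<Delta> + {#B#}) C \<Longrightarrow> derivable \<Gamma> (\<Delta> + {#A && B#}) C"
| topR: "derivable \<Gamma> \<Delta> Top"
| lolliR: "derivable \<Gamma> (\<Delta> + {#Atom a#}) B \<Longrightarrow> derivable \<Gamma> \<Delta> (a \<multimap> B)"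
| lolliL: "derivable \<Gamma> \<Delta>\<^sub>1 (Atom a) \<Longrightarrow> derivable \<Gamma> (\<Delta>\<^sub>2 + {#B#}) C \<Longrightarrow>
    derivable \<Gamma> (\<Delta>\<^sub>1 + \<Delta>\<^sub>2 + {#a \<multimap> B#}) C"
| bangR: "derivable \<Gamma> {#} A \<Longrightarrow> derivable \<Gamma> {#} (Bang A)"
| bangL: "derivable (\<Gamma> + {#A#}) \<Delta> C \<Longrightarrow> derivable \<Gamma> (\<Delta> + {#Bang A#}) C"

definition logical_le ::
  "'a form multiset \<times> 'a form multiset \<Rightarrow> 'a form multiset \<times> 'a form multiset \<Rightarrow> bool"
  (infix \<open>\<preceq>\<^sub>l\<close> 50) where
  "S\<^sub>1 \<preceq>\<^sub>l S\<^sub>2 \<longleftrightarrow>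
    (\<forall>\<Gamma>' \<Delta>' C. derivable (\<Gamma>' + fst S\<^sub>1) (\<Delta>' + snd S\<^sub>1) C \<longrightarrow>
               derivable (\<Gamma>' + fst S\<^sub>2) (\<Delta>' + snd S\<^sub>2) C)"

lemma derivable_persistent_mono:
  "derivable \<Gamma> \<Delta> C \<Longrightarrow> set_mset \<Gamma> \<subseteq> set_mset \<Gamma>' \<Longrightarrow> derivable \<Gamma>' \<Delta> C"
proof (induction arbitrary: \<Gamma>' rule: derivable.induct)
  case (clone \<Gamma> A \<Delta> C)
  then have "A \<in># \<Gamma>'" by auto
  then obtain \<Gamma>'' where "\<Gamma>' = \<Gamma>'' + {#A#}" by (metis add_mset_add_single mset_add)
  with clone show ?case by (metis derivable.clone)
next
  case (bangL \<Gamma> A \<Delta> C)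
  have "derivable (\<Gamma>' + {#A#}) \<Delta> C" by (rule bangL.IH) (use bangL.prems in auto)
  then show ?case by (rule derivable.bangL)
qed (blast intro: derivable.intros)+

text \<open>
  Multiplicities in the persistent context are irrelevant, so nothing is lost by viewing a
  finite set of formulas as the multiset in which each member occurs once.
\<close>

lemma derivable_persistent_set:
  "derivable (mset_set (set_mset \<Gamma>)) \<Delta> C \<longleftrightarrow> derivable \<Gamma> \<Delta> C"
  by (auto elim: derivable_persistent_mono)

text \<open>
  Structural congruence identifies persistent contexts with the same members; with finite sets
  in the first component it becomes equality of states.
\<close>

type_synonym 'a state = "'a form fset \<times> 'a form multiset"

definition compose :: "'a state \<Rightarrow> 'a state \<Rightarrow> 'a state"  (infixl \<open>\<parallel>\<close> 65) where
  "S\<^sub>1 \<parallel> S\<^sub>2 = (fst S\<^sub>1 |\<union>| fst S\<^sub>2, snd S\<^sub>1 + snd S\<^sub>2)"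

datatype 'a label = Tau | Out 'a | In 'a

inductive step :: "'a state \<Rightarrow> 'a label \<Rightarrow> 'a state \<Rightarrow> bool" where
  out: "step (\<Gamma>, \<Delta> + {#Atom a#}) (Out a) (\<Gamma>, \<Delta>)"
| inp: "step (\<Gamma>, \<Delta> + {#a \<multimap> B#}) (In a) (\<Gamma>, \<Delta> + {#B#})"
| comm: "step S\<^sub>1 (Out a) S\<^sub>1' \<Longrightarrow> step S\<^sub>2 (In a) S\<^sub>2' \<Longrightarrow> step (S\<^sub>1 \<parallel> S\<^sub>2) Tau (S\<^sub>1' \<parallel> S\<^sub>2')"
| tensor: "step (\<Gamma>, \<Delta> + {#A \<otimes> B#}) Tau (\<Gamma>, \<Delta> + {#A, B#})"
| one: "step (\<Gamma>, \<Delta> + {#One#}) Tau (\<Gamma>, \<Delta>)"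
| with1: "step (\<Gamma>, \<Delta> + {#A && B#}) Tau (\<Gamma>, \<Delta> + {#A#})"
| with2: "step (\<Gamma>, \<Delta> + {#A && B#}) Tau (\<Gamma>, \<Delta> + {#B#})"
| bang: "step (\<Gamma>, \<Delta> + {#Bang A#}) Tau (finsert A \<Gamma>, \<Delta>)"
| copy: "step (finsert A \<Gamma>, \<Delta>) Tau (finsert A \<Gamma>, \<Delta> + {#A#})"

abbreviation taus :: "'a state \<Rightarrow> 'a state \<Rightarrow> bool" where
  "taus \<equiv> (\<lambda>S S'. step S Tau S')\<^sup>*\<^sup>*"

definition wstep :: "'a state \<Rightarrow> 'a label \<Rightarrow> 'a state \<Rightarrow> bool" where
  "wstep S \<beta> S' \<longleftrightarrow>
    (if \<beta> = Tau then taus S S'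
     else (\<exists>T T'. taus S T \<and> step T \<beta> T' \<and> taus T' S'))"

definition simulation :: "('a state \<Rightarrow> 'a state \<Rightarrow> bool) \<Rightarrow> bool" where
  "simulation R \<longleftrightarrow> (\<forall>S\<^sub>1 S\<^sub>2. R S\<^sub>1 S\<^sub>2 \<longrightarrow>
     (\<forall>\<Gamma>\<^sub>1'. S\<^sub>1 = (\<Gamma>\<^sub>1', {#}) \<longrightarrow>
        (\<exists>\<Gamma>\<^sub>2'. wstep S\<^sub>2 Tau (\<Gamma>\<^sub>2', {#}) \<and> R (\<Gamma>\<^sub>1', {#}) (\<Gamma>\<^sub>2', {#}))) \<and>
     (\<forall>S\<^sub>1' S\<^sub>1''. S\<^sub>1 = S\<^sub>1' \<parallel> S\<^sub>1'' \<longrightarrow>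
        (\<exists>S\<^sub>2' S\<^sub>2''. wstep S\<^sub>2 Tau (S\<^sub>2' \<parallel> S\<^sub>2'') \<and> R S\<^sub>1' S\<^sub>2' \<and> R S\<^sub>1'' S\<^sub>2'')) \<and>
     (\<forall>\<alpha> S\<^sub>1'. (\<alpha> = Tau \<or> (\<exists>a. \<alpha> = Out a)) \<longrightarrow> step S\<^sub>1 \<alpha> S\<^sub>1' \<longrightarrow>
        (\<exists>S\<^sub>2'. wstep S\<^sub>2 \<alpha> S\<^sub>2' \<and> R S\<^sub>1' S\<^sub>2')) \<and>
     (\<forall>a S\<^sub>1'. step S\<^sub>1 (In a) S\<^sub>1' \<longrightarrow>
        (\<exists>S\<^sub>2'. wstep (fst S\<^sub>2, snd S\<^sub>2 + {#Atom a#}) Tau S\<^sub>2' \<and> R S\<^sub>1' S\<^sub>2')))"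

definition sim_le :: "'a state \<Rightarrow> 'a state \<Rightarrow> bool"  (infix \<open>\<preceq>\<^sub>s\<close> 50) where
  "S\<^sub>1 \<preceq>\<^sub>s S\<^sub>2 \<longleftrightarrow> (\<exists>R. simulation R \<and> R S\<^sub>1 S\<^sub>2)"

end

theory Submission
  imports Defs
begin

text \<open>
  The left rules of the sequent calculus are silent transitions read backwards, so derivability is
  generated by the right rules together with closure under backward silent steps. This gives
  inversion up to silent steps: for instance, a state entailing \<open>A \<otimes> B\<close> silently reaches a state
  that splits into a part entailing \<open>A\<close> and a part entailing \<open>B\<close>.

  From simulation to the logical preorder: similarity is preserved by composition, and a state
  simulating a state that entails \<open>C\<close> entails \<open>C\<close>, by induction on the entailment.

  From the logical preorder to simulation: \<open>S\<^sub>2\<close> entails the tensor of everything in \<open>S\<^sub>1\<close>, hence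
  silently reaches a state whose linear context splits into pieces entailing the individual linear
  formulas of \<open>S\<^sub>1\<close>, and whose persistent context entails those of \<open>S\<^sub>1\<close>. The relation so described
  is itself a simulation. No cut elimination is required.
\<close>

section \<open>Transitions and composition\<close>

lemma compose_Pair [simp]: "(\<Gamma>\<^sub>1, \<Delta>\<^sub>1) \<parallel> (\<Gamma>\<^sub>2, \<Delta>\<^sub>2) = (\<Gamma>\<^sub>1 |\<union>| \<Gamma>\<^sub>2, \<Delta>\<^sub>1 + \<Delta>\<^sub>2)"
  by (simp add: compose_def)

lemma compose_commute: "S \<parallel> T = T \<parallel> S"
  by (simp add: compose_def ac_simps sup_commute)

lemma step_Out_iff:
  "step (\<Gamma>, \<Delta>) (Out a) S' \<longleftrightarrow> (\<exists>\<Delta>\<^sub>0. \<Delta> = add_mset (Atom a) \<Delta>\<^sub>0 \<and> S' = (\<Gamma>, \<Delta>\<^sub>0))"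
  by (auto elim: step.cases intro: step.out[of _ _ a, simplified])

lemma step_In_iff:
  "step (\<Gamma>, \<Delta>) (In a) S' \<longleftrightarrow>
    (\<exists>\<Delta>\<^sub>0 B. \<Delta> = add_mset (a \<multimap> B) \<Delta>\<^sub>0 \<and> S' = (\<Gamma>, add_mset B \<Delta>\<^sub>0))"
  by (fastforce elim: step.cases intro: step.inp[of _ _ a, simplified])

lemma step_Out: "step (\<Gamma>, add_mset (Atom a) \<Delta>) (Out a) (\<Gamma>, \<Delta>)"
  by (simp add: step_Out_iff)

lemma step_In: "step (\<Gamma>, add_mset (a \<multimap> B) \<Delta>) (In a) (\<Gamma>, add_mset B \<Delta>)"
  using step.inp[of \<Gamma> \<Delta> a B] by simp

text \<open>These are the five silent rules that replace a single linear formula. The result is a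
  state and not a multiset because \<open>Bang\<close> feeds the persistent context; composing it
  with the rest treats all five alike.\<close>

inductive unfolds :: "'a form \<Rightarrow> 'a state \<Rightarrow> bool" where
  "unfolds (A \<otimes> B) ({||}, {#A, B#})"
| "unfolds One ({||}, {#})"
| "unfolds (A && B) ({||}, {#A#})"
| "unfolds (A && B) ({||}, {#B#})"
| "unfolds (Bang A) ({|A|}, {#})"

lemma step_unfold: "unfolds F N \<Longrightarrow> step (\<Gamma>, add_mset F \<Delta>) Tau ((\<Gamma>, \<Delta>) \<parallel> N)"
  using step.tensor[of \<Gamma> \<Delta>] step.one[of \<Gamma> \<Delta>] step.with1[of \<Gamma> \<Delta>] step.with2[of \<Gamma> \<Delta>]
    step.bang[of \<Gamma> \<Delta>]
  by (auto elim!: unfolds.cases)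

lemma step_copy: "A |\<in>| \<Gamma> \<Longrightarrow> step (\<Gamma>, \<Delta>) Tau (\<Gamma>, add_mset A \<Delta>)"
  using step.copy[of A \<Gamma> \<Delta>] by (simp add: finsert_absorb)

lemma step_comm:
  "step (\<Gamma>, add_mset (Atom a) (add_mset (a \<multimap> B) \<Delta>)) Tau (\<Gamma>, add_mset B \<Delta>)"
  using step.comm[OF step.out[of \<Gamma> "{#}" a] step.inp[of \<Gamma> \<Delta> a B]]
  by (simp add: add_mset_commute)

text \<open>The communication rule speaks of an arbitrary splitting of the state. Outputs and inputs
  leave persistent contexts alone, so the splitting can be forgotten: only a matching atom and
  implication in the flat multiset remain.\<close>

lemma step_Tau_cases:
  assumes "step (\<Gamma>, \<Delta>) Tau U"
  obtains
    (unfold) F \<Delta>\<^sub>0 N where "\<Delta> = add_mset F \<Delta>\<^sub>0" "unfolds F N" "U = (\<Gamma>, \<Delta>\<^sub>0) \<parallel> N"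
  | (copy) A where "A |\<in>| \<Gamma>" "U = (\<Gamma>, add_mset A \<Delta>)"
  | (comm) a B \<Delta>\<^sub>0 where "\<Delta> = add_mset (Atom a) (add_mset (a \<multimap> B) \<Delta>\<^sub>0)"
      "U = (\<Gamma>, add_mset B \<Delta>\<^sub>0)"
  using assms
proof (cases rule: step.cases)
  case (comm S\<^sub>1 a S\<^sub>1' S\<^sub>2 S\<^sub>2')
  obtain \<Gamma>\<^sub>1 \<Delta>\<^sub>1 \<Gamma>\<^sub>2 \<Delta>\<^sub>2 where S: "S\<^sub>1 = (\<Gamma>\<^sub>1, \<Delta>\<^sub>1)" "S\<^sub>2 = (\<Gamma>\<^sub>2, \<Delta>\<^sub>2)"
    by (cases S\<^sub>1, cases S\<^sub>2)
  with comm obtain K L B where KL: "\<Delta>\<^sub>1 = add_mset (Atom a) K" "S\<^sub>1' = (\<Gamma>\<^sub>1, K)"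
    "\<Delta>\<^sub>2 = add_mset (a \<multimap> B) L" "S\<^sub>2' = (\<Gamma>\<^sub>2, add_mset B L)"
    by (auto simp: step_Out_iff step_In_iff)
  with comm S show thesis
    by (intro that(3)[of a B "K + L"]) (auto simp: add_mset_commute)
next
  case (tensor \<Delta>' A B)
  then show thesis using that(1)[OF _ unfolds.intros(1)] by auto
next
  case (one \<Delta>')
  then show thesis using that(1)[OF _ unfolds.intros(2)] by auto
next
  case (with1 \<Delta>' A B)
  then show thesis using that(1)[OF _ unfolds.intros(3)] by auto
next
  case (with2 \<Delta>' A B)
  then show thesis using that(1)[OF _ unfolds.intros(4)] by auto
next
  case (bang \<Delta>' A)
  then show thesis using that(1)[OF _ unfolds.intros(5)] by auto
next
  case (copy A \<Gamma>')
  then show thesis using that(2)[of A] by simp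
qed

section \<open>Transitions and splittings of composed states\<close>

lemma step_compose:
  assumes "step S \<alpha> S'"
  shows "step (S \<parallel> T) \<alpha> (S' \<parallel> T)"
proof -
  obtain \<Gamma> \<Delta> \<Gamma>\<^sub>T \<Delta>\<^sub>T where S: "S = (\<Gamma>, \<Delta>)" and T: "T = (\<Gamma>\<^sub>T, \<Delta>\<^sub>T)"
    by (cases S, cases T)
  show ?thesis
  proof (cases \<alpha>)
    case Tau
    with assms S have "step (\<Gamma>, \<Delta>) Tau S'" by simp
    then show ?thesis
    proof (cases rule: step_Tau_cases)
      case (unfold F \<Delta>\<^sub>0 N)
      then show ?thesis
        using step_unfold[of F N "\<Gamma> |\<union>| \<Gamma>\<^sub>T" "\<Delta>\<^sub>0 + \<Delta>\<^sub>T"]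
        by (cases N) (simp add: S T Tau ac_simps sup.commute sup.left_commute)
    next
      case (copy A)
      then show ?thesis
        using step_copy[of A "\<Gamma> |\<union>| \<Gamma>\<^sub>T" "\<Delta> + \<Delta>\<^sub>T"] by (simp add: S T Tau)
    next
      case (comm a B \<Delta>\<^sub>0)
      then show ?thesis
        using step_comm[of "\<Gamma> |\<union>| \<Gamma>\<^sub>T" a B "\<Delta>\<^sub>0 + \<Delta>\<^sub>T"] by (simp add: S T Tau)
    qed
  qed (use assms S T in \<open>auto simp: step_Out_iff step_In_iff[of \<Gamma>] intro: step_In\<close>)
qed

lemma taus_compose:
  assumes "taus S S'"
  shows "taus (S \<parallel> T) (S' \<parallel> T)"
  using assms by induction (auto intro: rtranclp.rtrancl_into_rtrancl step_compose)

lemma taus_add: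
  "taus (\<Gamma>, \<Delta>) (\<Gamma>', \<Delta>') \<Longrightarrow> taus (\<Gamma>, \<Delta> + \<Delta>\<^sub>0) (\<Gamma>', \<Delta>' + \<Delta>\<^sub>0)"
  using taus_compose[of "(\<Gamma>, \<Delta>)" "(\<Gamma>', \<Delta>')" "({||}, \<Delta>\<^sub>0)"] by simp

text \<open>No rule discards a persistent formula. Together with \<open>entails_mono\<close> this
  carries entailments over to later states of a silent run.\<close>

lemma step_Tau_persistent_mono:
  assumes "step S Tau S'"
  shows "fst S |\<subseteq>| fst S'"
proof -
  obtain \<Gamma> \<Delta> where "S = (\<Gamma>, \<Delta>)" by (cases S)
  with assms have "step (\<Gamma>, \<Delta>) Tau S'" by simp
  then show ?thesis
    by (cases rule: step_Tau_cases) (auto simp: \<open>S = (\<Gamma>, \<Delta>)\<close> compose_def)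
qed

lemma taus_persistent_mono: "taus S S' \<Longrightarrow> fst S |\<subseteq>| fst S'"
  by (induction rule: rtranclp_induct) (auto dest!: step_Tau_persistent_mono)

text \<open>A silent step touches one linear formula, one persistent formula, or an atom with its
  implication. The first two can be attributed to one side; the last pair may straddle the
  composition, which accounts for the two mixed cases.\<close>

lemma step_Tau_compose_cases:
  assumes "step (S \<parallel> T) Tau U"
  obtains
    (left) S' where "step S Tau S'" "U = S' \<parallel> T"
  | (right) T' where "step T Tau T'" "U = S \<parallel> T'"
  | (left_right) a S' T' where "step S (Out a) S'" "step T (In a) T'" "U = S' \<parallel> T'"
  | (right_left) a S' T' where "step S (In a) S'" "step T (Out a) T'" "U = S' \<parallel> T'"
proof -
  obtain \<Gamma> \<Delta> \<Gamma>\<^sub>T \<Delta>\<^sub>T where S: "S = (\<Gamma>, \<Delta>)" and T: "T = (\<Gamma>\<^sub>T, \<Delta>\<^sub>T)"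
    by (cases S, cases T)
  with assms have "step (\<Gamma> |\<union>| \<Gamma>\<^sub>T, \<Delta> + \<Delta>\<^sub>T) Tau U" by simp
  then show thesis
  proof (cases rule: step_Tau_cases)
    case (unfold F \<Delta>\<^sub>0 N)
    obtain \<Gamma>\<^sub>N \<Delta>\<^sub>N where N: "N = (\<Gamma>\<^sub>N, \<Delta>\<^sub>N)" by (cases N)
    have "F \<in># \<Delta> \<or> F \<in># \<Delta>\<^sub>T" using unfold(1) by (metis union_iff union_single_eq_member)
    then show thesis
    proof
      assume "F \<in># \<Delta>"
      then obtain K where K: "\<Delta> = add_mset F K" by (metis mset_add)
      with unfold(1) have "\<Delta>\<^sub>0 = K + \<Delta>\<^sub>T" by simp
      with unfold N S T K show thesis
        using left[of "(\<Gamma>, K) \<parallel> N"] step_unfold[of F N \<Gamma> K]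
        by (simp add: ac_simps sup.commute sup.left_commute)
    next
      assume "F \<in># \<Delta>\<^sub>T"
      then obtain K where K: "\<Delta>\<^sub>T = add_mset F K" by (metis mset_add)
      with unfold(1) have "\<Delta>\<^sub>0 = \<Delta> + K" by simp
      with unfold N S T K show thesis
        using right[of "(\<Gamma>\<^sub>T, K) \<parallel> N"] step_unfold[of F N \<Gamma>\<^sub>T K]
        by (simp add: ac_simps sup.commute sup.left_commute)
    qed
  next
    case (copy A)
    then show thesis
      using left[OF step_copy[of A \<Gamma> \<Delta>, folded S]] right[OF step_copy[of A \<Gamma>\<^sub>T \<Delta>\<^sub>T, folded T]]
      by (auto simp: S T)
  next
    case (comm a B \<Delta>\<^sub>0)
    have mem: "Atom a \<in># \<Delta> + \<Delta>\<^sub>T" "a \<multimap> B \<in># \<Delta> + \<Delta>\<^sub>T" using comm(1) by simp_all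
    consider
        "Atom a \<in># \<Delta>" "a \<multimap> B \<in># \<Delta>" | "Atom a \<in># \<Delta>\<^sub>T" "a \<multimap> B \<in># \<Delta>\<^sub>T"
      | "Atom a \<in># \<Delta>" "a \<multimap> B \<in># \<Delta>\<^sub>T" | "Atom a \<in># \<Delta>\<^sub>T" "a \<multimap> B \<in># \<Delta>"
      using mem by auto
    then show thesis
    proof cases
      case 1
      \<comment> \<open>Atom and implication are different formulas, so removing the first leaves
        the second in place.\<close>
      then obtain K where K: "\<Delta> = add_mset (Atom a) (add_mset (a \<multimap> B) K)"
        by (metis form.distinct(9) insert_noteq_member mset_add)
      then show thesis
        using comm left[of "(\<Gamma>, add_mset B K)"] step_comm[of \<Gamma> a B K] by (simp add: S T)
    next
      case 2
      then obtain K where K: "\<Delta>\<^sub>T = add_mset (Atom a) (add_mset (a \<multimap> B) K)"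
        by (metis form.distinct(9) insert_noteq_member mset_add)
      then show thesis
        using comm right[of "(\<Gamma>\<^sub>T, add_mset B K)"] step_comm[of \<Gamma>\<^sub>T a B K] by (simp add: S T)
    next
      case 3
      then obtain K L where "\<Delta> = add_mset (Atom a) K" "\<Delta>\<^sub>T = add_mset (a \<multimap> B) L"
        by (metis mset_add)
      then show thesis
        using comm left_right[of a "(\<Gamma>, K)" "(\<Gamma>\<^sub>T, add_mset B L)"]
        by (simp add: S T step_Out step_In)
    next
      case 4
      then obtain K L where "\<Delta> = add_mset (a \<multimap> B) K" "\<Delta>\<^sub>T = add_mset (Atom a) L"
        by (metis mset_add)
      then show thesis
        using comm right_left[of a "(\<Gamma>, add_mset B K)" "(\<Gamma>\<^sub>T, L)"]
        by (simp add: S T step_Out step_In)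
    qed
  qed
qed

text \<open>This is the Riesz refinement property. For linear contexts the four cells are the
  overlap of \<open>\<Delta>\<^sub>S\<close> and \<open>\<Delta>\<^sub>U\<close>, the two
  differences, and what remains; for persistent contexts pairwise intersections suffice, as union
  tolerates overlap. It serves the splitting clause in \<open>sim_le_compose\<close>.\<close>

lemma compose_refinement:
  assumes "S \<parallel> T = U \<parallel> V"
  obtains S\<^sub>1 S\<^sub>2 T\<^sub>1 T\<^sub>2 where "S = S\<^sub>1 \<parallel> S\<^sub>2" "T = T\<^sub>1 \<parallel> T\<^sub>2" "U = S\<^sub>1 \<parallel> T\<^sub>1" "V = S\<^sub>2 \<parallel> T\<^sub>2"
proof -
  obtain \<Gamma>\<^sub>S \<Delta>\<^sub>S \<Gamma>\<^sub>T \<Delta>\<^sub>T \<Gamma>\<^sub>U \<Delta>\<^sub>U \<Gamma>\<^sub>V \<Delta>\<^sub>V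
    where st: "S = (\<Gamma>\<^sub>S, \<Delta>\<^sub>S)" "T = (\<Gamma>\<^sub>T, \<Delta>\<^sub>T)" "U = (\<Gamma>\<^sub>U, \<Delta>\<^sub>U)" "V = (\<Gamma>\<^sub>V, \<Delta>\<^sub>V)"
    by (cases S, cases T, cases U, cases V)
  have \<Gamma>: "\<Gamma>\<^sub>S |\<union>| \<Gamma>\<^sub>T = \<Gamma>\<^sub>U |\<union>| \<Gamma>\<^sub>V" and \<Delta>: "\<Delta>\<^sub>S + \<Delta>\<^sub>T = \<Delta>\<^sub>U + \<Delta>\<^sub>V" using assms st by auto
  have c: "count \<Delta>\<^sub>S x + count \<Delta>\<^sub>T x = count \<Delta>\<^sub>U x + count \<Delta>\<^sub>V x" for x
    using \<Delta> by (metis count_union)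
  have d12: "\<Delta>\<^sub>S = \<Delta>\<^sub>S \<inter># \<Delta>\<^sub>U + (\<Delta>\<^sub>S - \<Delta>\<^sub>U)" "\<Delta>\<^sub>U = \<Delta>\<^sub>S \<inter># \<Delta>\<^sub>U + (\<Delta>\<^sub>U - \<Delta>\<^sub>S)"
    by (auto simp: multiset_eq_iff)
  have d3: "\<Delta>\<^sub>T = (\<Delta>\<^sub>U - \<Delta>\<^sub>S) + (\<Delta>\<^sub>T - (\<Delta>\<^sub>U - \<Delta>\<^sub>S))"
  proof (rule multiset_eqI)
    fix x show "count \<Delta>\<^sub>T x = count ((\<Delta>\<^sub>U - \<Delta>\<^sub>S) + (\<Delta>\<^sub>T - (\<Delta>\<^sub>U - \<Delta>\<^sub>S))) x"
      using c[of x] by simp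
  qed
  have d4: "\<Delta>\<^sub>V = (\<Delta>\<^sub>S - \<Delta>\<^sub>U) + (\<Delta>\<^sub>T - (\<Delta>\<^sub>U - \<Delta>\<^sub>S))"
  proof (rule multiset_eqI)
    fix x show "count \<Delta>\<^sub>V x = count ((\<Delta>\<^sub>S - \<Delta>\<^sub>U) + (\<Delta>\<^sub>T - (\<Delta>\<^sub>U - \<Delta>\<^sub>S))) x"
      using c[of x] by simp
  qed
  have g: "\<Gamma>\<^sub>S = (\<Gamma>\<^sub>S |\<inter>| \<Gamma>\<^sub>U) |\<union>| (\<Gamma>\<^sub>S |\<inter>| \<Gamma>\<^sub>V)" "\<Gamma>\<^sub>T = (\<Gamma>\<^sub>T |\<inter>| \<Gamma>\<^sub>U) |\<union>| (\<Gamma>\<^sub>T |\<inter>| \<Gamma>\<^sub>V)"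
    "\<Gamma>\<^sub>U = (\<Gamma>\<^sub>S |\<inter>| \<Gamma>\<^sub>U) |\<union>| (\<Gamma>\<^sub>T |\<inter>| \<Gamma>\<^sub>U)" "\<Gamma>\<^sub>V = (\<Gamma>\<^sub>S |\<inter>| \<Gamma>\<^sub>V) |\<union>| (\<Gamma>\<^sub>T |\<inter>| \<Gamma>\<^sub>V)"
    using \<Gamma> by blast+
  show thesis
    by (intro that[of "(\<Gamma>\<^sub>S |\<inter>| \<Gamma>\<^sub>U, \<Delta>\<^sub>S \<inter># \<Delta>\<^sub>U)" "(\<Gamma>\<^sub>S |\<inter>| \<Gamma>\<^sub>V, \<Delta>\<^sub>S - \<Delta>\<^sub>U)"
          "(\<Gamma>\<^sub>T |\<inter>| \<Gamma>\<^sub>U, \<Delta>\<^sub>U - \<Delta>\<^sub>S)" "(\<Gamma>\<^sub>T |\<inter>| \<Gamma>\<^sub>V, \<Delta>\<^sub>T - (\<Delta>\<^sub>U - \<Delta>\<^sub>S))"])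
      (simp_all only: st compose_Pair g[symmetric] d12[symmetric] d3[symmetric] d4[symmetric])
qed

section \<open>Entailment as backward silent steps plus right rules\<close>

inductive entails :: "'a state \<Rightarrow> 'a form \<Rightarrow> bool"  (infix \<open>\<tturnstile>\<close> 50) where
  tau: "step S Tau S' \<Longrightarrow> S' \<tturnstile> C \<Longrightarrow> S \<tturnstile> C"
| atom: "(\<Gamma>, {#Atom a#}) \<tturnstile> Atom a"
| tensor: "(\<Gamma>, \<Delta>\<^sub>1) \<tturnstile> A \<Longrightarrow> (\<Gamma>, \<Delta>\<^sub>2) \<tturnstile> B \<Longrightarrow> (\<Gamma>, \<Delta>\<^sub>1 + \<Delta>\<^sub>2) \<tturnstile> A \<otimes> B"
| one: "(\<Gamma>, {#}) \<tturnstile> One"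
| conj: "S \<tturnstile> A \<Longrightarrow> S \<tturnstile> B \<Longrightarrow> S \<tturnstile> A && B"
| top: "S \<tturnstile> Top"
| lolli: "(\<Gamma>, add_mset (Atom a) \<Delta>) \<tturnstile> B \<Longrightarrow> (\<Gamma>, \<Delta>) \<tturnstile> a \<multimap> B"
| bang: "(\<Gamma>, {#}) \<tturnstile> A \<Longrightarrow> (\<Gamma>, {#}) \<tturnstile> Bang A"

lemmas entails_right_intros =
  entails.atom entails.tensor entails.one entails.conj entails.top entails.lolli entails.bang

section \<open>Weakening, inversion and identity for entailment\<close>

lemma entails_taus: "taus S S' \<Longrightarrow> S' \<tturnstile> C \<Longrightarrow> S \<tturnstile> C"
  by (induction rule: converse_rtranclp_induct) (assumption, rule entails.tau)

text \<open>Silent steps survive by framing, and every right rule is stated for an arbitrary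
  persistent context.\<close>

lemma entails_weaken:
  assumes "S \<tturnstile> C"
  shows "S \<parallel> (\<Gamma>', {#}) \<tturnstile> C"
  using assms
proof induction
  case (tau S S' C)
  then show ?case using entails.tau[OF step_compose] by blast
next
  case (tensor \<Gamma> \<Delta>\<^sub>1 A \<Delta>\<^sub>2 B)
  then show ?case using entails.tensor[of "\<Gamma> |\<union>| \<Gamma>'"] by simp
next
  case (lolli \<Gamma> a \<Delta> B)
  then show ?case using entails.lolli[of "\<Gamma> |\<union>| \<Gamma>'"] by simp
qed (simp_all add: entails_right_intros)

lemma entails_mono: "(\<Gamma>, \<Delta>) \<tturnstile> C \<Longrightarrow> \<Gamma> |\<subseteq>| \<Gamma>' \<Longrightarrow> (\<Gamma>', \<Delta>) \<tturnstile> C"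
  using entails_weaken[of "(\<Gamma>, \<Delta>)" C \<Gamma>'] by (simp add: sup.absorb2)

text \<open>The rule \<open>tau\<close> only lengthens the run, so a right rule is exposed after
  finitely many silent steps. One induction serves all connectives whose right rule constrains the
  linear context; \<open>&&\<close> and \<open>\<multimap>\<close> have sharper inversions, without
  silent steps, in \<open>entails_With\<close> and \<open>entails_Lolli\<close>.\<close>

lemma entails_taus_right:
  assumes "S \<tturnstile> C"
  shows "\<exists>\<Gamma> \<Delta>. taus S (\<Gamma>, \<Delta>) \<and> (case C of
      Atom a \<Rightarrow> \<Delta> = {#Atom a#}
    | One \<Rightarrow> \<Delta> = {#}
    | A \<otimes> B \<Rightarrow> \<exists>\<Delta>\<^sub>1 \<Delta>\<^sub>2. \<Delta> = \<Delta>\<^sub>1 + \<Delta>\<^sub>2 \<and> (\<Gamma>, \<Delta>\<^sub>1) \<tturnstile> A \<and> (\<Gamma>, \<Delta>\<^sub>2) \<tturnstile> B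
    | Bang A \<Rightarrow> \<Delta> = {#} \<and> (\<Gamma>, {#}) \<tturnstile> A
    | _ \<Rightarrow> True)"
  using assms
proof induction
  case (tau S S' C)
  then show ?case
    using converse_rtranclp_into_rtranclp[of "\<lambda>S S'. step S Tau S'", OF tau.hyps(1)] by blast
next
  case (tensor \<Gamma> \<Delta>\<^sub>1 A \<Delta>\<^sub>2 B)
  then show ?case unfolding form.case by blast
next
  case (conj S A B)
  then show ?case by (cases S) auto
next
  case (top S)
  then show ?case by (cases S) auto
qed auto

lemma entails_Atom:
  assumes "S \<tturnstile> Atom a"
  obtains \<Gamma>' where "taus S (\<Gamma>', {#Atom a#})"
  using entails_taus_right[OF assms] by auto

lemma entails_One:
  assumes "S \<tturnstile> One"
  obtains \<Gamma>' where "taus S (\<Gamma>', {#})"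
  using entails_taus_right[OF assms] by auto

lemma entails_Tensor:
  assumes "S \<tturnstile> A \<otimes> B"
  obtains \<Gamma>' \<Delta>\<^sub>1 \<Delta>\<^sub>2 where "taus S (\<Gamma>', \<Delta>\<^sub>1 + \<Delta>\<^sub>2)" "(\<Gamma>', \<Delta>\<^sub>1) \<tturnstile> A" "(\<Gamma>', \<Delta>\<^sub>2) \<tturnstile> B"
  using entails_taus_right[OF assms] by auto

lemma entails_Bang:
  assumes "S \<tturnstile> Bang A"
  obtains \<Gamma>' where "taus S (\<Gamma>', {#})" "(\<Gamma>', {#}) \<tturnstile> A"
  using entails_taus_right[OF assms] by auto

text \<open>Both premises of the right rule concern the same state, so a preceding silent step can
  be prepended to each separately.\<close>

lemma entails_With:
  assumes "S \<tturnstile> A && B"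
  shows "S \<tturnstile> A \<and> S \<tturnstile> B"
  using assms
proof (induction S "A && B")
  case (tau S S')
  then show ?case using entails.tau[OF tau.hyps(1)] by blast
qed simp

text \<open>The extra atom rides along as a frame through the preceding silent steps until the right
  rule is reached.\<close>

lemma entails_Lolli:
  assumes "S \<tturnstile> a \<multimap> B"
  shows "S \<parallel> ({||}, {#Atom a#}) \<tturnstile> B"
  using assms
proof (induction S "a \<multimap> B")
  case (tau S S')
  then show ?case using entails.tau[OF step_compose] by blast
qed simp

text \<open>Identity expansion: the formula is taken apart by silent steps and rebuilt by its right
  rule. The \<open>Bang\<close> case relies on generality in \<Gamma>, since there the body becomes
  persistent.\<close>

lemma entails_identity: "(\<Gamma>, {#A#}) \<tturnstile> A"
proof (induction A arbitrary: \<Gamma>)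
  case (Tensor A B)
  have "(\<Gamma>, {#A#} + {#B#}) \<tturnstile> A \<otimes> B" by (intro entails.tensor Tensor.IH)
  then show ?case using step_unfold[OF unfolds.intros(1)[of A B], of \<Gamma> "{#}"]
    by (auto simp: add_mset_commute intro: entails.tau)
next
  case One
  show ?case using step_unfold[OF unfolds.intros(2), of \<Gamma> "{#}"]
    by (auto intro: entails.tau entails.one)
next
  case (With A B)
  show ?case
    using step_unfold[OF unfolds.intros(3)[of A B], of \<Gamma> "{#}"]
      step_unfold[OF unfolds.intros(4)[of A B], of \<Gamma> "{#}"] With.IH
    by (auto intro!: entails.conj intro: entails.tau)
next
  case (Lolli a B)
  show ?case
    using step_comm[of \<Gamma> a B "{#}"] Lolli.IH by (auto intro!: entails.lolli intro: entails.tau)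
next
  case (Bang A)
  \<comment> \<open>The right rule for \<open>Bang\<close> wants an empty linear context, so the
    copy of A is made only in its premise.\<close>
  have "(finsert A \<Gamma>, {#}) \<tturnstile> Bang A"
    using step_copy[of A "finsert A \<Gamma>" "{#}"] Bang.IH
    by (auto intro!: entails.bang intro: entails.tau)
  then show ?case using step_unfold[OF unfolds.intros(5)[of A], of \<Gamma> "{#}"]
    by (auto intro: entails.tau)
qed (auto intro: entails_right_intros)

section \<open>Agreement of derivability with entailment\<close>

lemma derivable_step_Tau:
  assumes "step (\<Gamma>, \<Delta>) Tau (\<Gamma>', \<Delta>')" "derivable (mset_set (fset \<Gamma>')) \<Delta>' C"
  shows "derivable (mset_set (fset \<Gamma>)) \<Delta> C"
  using assms(1)
proof (cases rule: step_Tau_cases)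
  case (unfold F \<Delta>\<^sub>0 N)
  show ?thesis using unfold(2)
  proof cases
    case (5 A)
    \<comment> \<open>If A is persistent already, the two multisets differ in multiplicity;
      \<open>derivable_persistent_mono\<close> compares only members.\<close>
    have "derivable (mset_set (fset \<Gamma>) + {#A#}) \<Delta>\<^sub>0 C"
      using assms(2) unfold(3) 5 by (auto elim!: derivable_persistent_mono)
    then show ?thesis using 5 unfold(1) derivable.bangL by fastforce
  qed (use assms(2) unfold derivable.tensorL[of _ \<Delta>\<^sub>0] derivable.oneL[of _ \<Delta>\<^sub>0]
      derivable.withL1[of _ \<Delta>\<^sub>0] derivable.withL2[of _ \<Delta>\<^sub>0] in simp_all)
next
  case (copy A)
  then obtain G where "mset_set (fset \<Gamma>) = G + {#A#}"
    by (metis add_mset_add_single finite_fset finite_set_mset_mset_set mset_add)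
  then show ?thesis using copy assms(2) derivable.clone[of G A \<Delta> C] by simp
next
  \<comment> \<open>Communication is the left rule for implication with its minor premise closed by
    \<open>init\<close>.\<close>
  case (comm a B \<Delta>\<^sub>0)
  then show ?thesis
    using assms(2) derivable.lolliL[OF derivable.init, of _ \<Delta>\<^sub>0 B C a]
    by (simp add: add_mset_commute)
qed

lemma derivable_if_entails:
  assumes "S \<tturnstile> C"
  shows "derivable (mset_set (fset (fst S))) (snd S) C"
  using assms
proof induction
  case (tau S S' C)
  then show ?case using derivable_step_Tau by (metis prod.collapse)
next
  case (lolli \<Gamma> a \<Delta> B)
  then show ?case by (auto intro: derivable.lolliR)
qed (auto intro: derivable.intros)

lemma entails_if_derivable:
  assumes "derivable G \<Delta> C" "fset \<Gamma> = set_mset G"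
  shows "(\<Gamma>, \<Delta>) \<tturnstile> C"
  using assms
proof (induction arbitrary: \<Gamma>)
  case (clone G A \<Delta> C)
  then show ?case using step_copy[of A \<Gamma> \<Delta>] by (auto intro: entails.tau)
next
  case (tensorL G \<Delta> A B C)
  then show ?case using step_unfold[OF unfolds.intros(1)[of A B], of \<Gamma> \<Delta>]
    by (auto intro: entails.tau)
next
  case (oneL G \<Delta> C)
  then show ?case using step_unfold[OF unfolds.intros(2), of \<Gamma> \<Delta>] by (auto intro: entails.tau)
next
  case (withL1 G \<Delta> A C B)
  then show ?case using step_unfold[OF unfolds.intros(3)[of A B], of \<Gamma> \<Delta>]
    by (auto intro: entails.tau)
next
  case (withL2 G \<Delta> B C A)
  then show ?case using step_unfold[OF unfolds.intros(4)[of A B], of \<Gamma> \<Delta>]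
    by (auto intro: entails.tau)
next
  case (lolliL G \<Delta>\<^sub>1 a \<Delta>\<^sub>2 B C)
  \<comment> \<open>The minor premise only derives the atom, whereas communication needs the atom
    itself. Inversion gives a silent run from \<open>\<Delta>\<^sub>1\<close> to the bare atom, and
    the other premise is weakened to the persistent context reached.\<close>
  obtain \<Gamma>' where \<Gamma>': "taus (\<Gamma>, \<Delta>\<^sub>1) (\<Gamma>', {#Atom a#})"
    using lolliL.IH(1)[OF lolliL.prems] by (rule entails_Atom)
  have "(\<Gamma>', add_mset B \<Delta>\<^sub>2) \<tturnstile> C"
    using lolliL.IH(2)[OF lolliL.prems] taus_persistent_mono[OF \<Gamma>'] by (auto intro: entails_mono)
  then have "(\<Gamma>', {#Atom a#} + (\<Delta>\<^sub>2 + {#a \<multimap> B#})) \<tturnstile> C"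
    using entails.tau[OF step_comm[of \<Gamma>' a B \<Delta>\<^sub>2]] by (simp add: add_mset_commute)
  then have "(\<Gamma>, \<Delta>\<^sub>1 + (\<Delta>\<^sub>2 + {#a \<multimap> B#})) \<tturnstile> C" by (rule entails_taus[OF taus_add[OF \<Gamma>']])
  then show ?case by (simp only: add.assoc)
next
  case (bangL G A \<Delta> C)
  then have "(finsert A \<Gamma>, \<Delta>) \<tturnstile> C" by simp
  then show ?case using step_unfold[OF unfolds.intros(5)[of A], of \<Gamma> \<Delta>]
    by (auto intro: entails.tau)
qed (auto intro: entails_right_intros)

lemma derivable_iff_entails:
  "fset \<Gamma> = set_mset G \<Longrightarrow> derivable G \<Delta> C \<longleftrightarrow> (\<Gamma>, \<Delta>) \<tturnstile> C"
  using derivable_if_entails[of "(\<Gamma>, \<Delta>)" C] entails_if_derivable[of G \<Delta> C \<Gamma>]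
  by (auto simp: derivable_persistent_set)

lemma logical_le_iff_entails:
  "(mset_set (fset \<Gamma>\<^sub>1), \<Delta>\<^sub>1) \<preceq>\<^sub>l (mset_set (fset \<Gamma>\<^sub>2), \<Delta>\<^sub>2) \<longleftrightarrow>
    (\<forall>T C. T \<parallel> (\<Gamma>\<^sub>1, \<Delta>\<^sub>1) \<tturnstile> C \<longrightarrow> T \<parallel> (\<Gamma>\<^sub>2, \<Delta>\<^sub>2) \<tturnstile> C)"
proof -
  have eq: "derivable (G + mset_set (fset \<Gamma>)) \<Delta> C \<longleftrightarrow> (\<Gamma>' |\<union>| \<Gamma>, \<Delta>) \<tturnstile> C"
    if "fset \<Gamma>' = set_mset G" for G \<Gamma> \<Gamma>' \<Delta> and C :: "'a form"
    using that by (intro derivable_iff_entails) auto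
  \<comment> \<open>Every multiset has the members of some finite set and conversely, so quantifying
    over persistent contexts of either kind amounts to the same.\<close>
  have "\<exists>\<Gamma>'. fset \<Gamma>' = set_mset G" for G :: "'a form multiset"
    by (metis finite_fset fset_cases finite_set_mset mem_Collect_eq)
  moreover have "\<exists>G. fset \<Gamma>' = set_mset G" for \<Gamma>' :: "'a form fset"
    by (metis finite_fset finite_set_mset_mset_set)
  ultimately show ?thesis
    unfolding logical_le_def split_paired_All compose_Pair fst_conv snd_conv by (metis eq)
qed

section \<open>Similarity implies the logical preorder\<close>

lemma wstep_Tau [simp]: "wstep S Tau S' \<longleftrightarrow> taus S S'"
  by (simp add: wstep_def)

lemma wstep_Out [simp]:
  "wstep S (Out a) S' \<longleftrightarrow> (\<exists>T T'. taus S T \<and> step T (Out a) T' \<and> taus T' S')"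
  by (simp add: wstep_def)

lemma compose_Atom: "(fst S, snd S + {#Atom a#}) = S \<parallel> ({||}, {#Atom a#})"
  by (simp add: compose_def)

lemma simulationI:
  assumes "\<And>\<Gamma> S\<^sub>2. R (\<Gamma>, {#}) S\<^sub>2 \<Longrightarrow> \<exists>\<Gamma>'. taus S\<^sub>2 (\<Gamma>', {#}) \<and> R (\<Gamma>, {#}) (\<Gamma>', {#})"
    and "\<And>S S' S\<^sub>2. R (S \<parallel> S') S\<^sub>2 \<Longrightarrow> \<exists>T T'. taus S\<^sub>2 (T \<parallel> T') \<and> R S T \<and> R S' T'"
    and "\<And>S S' S\<^sub>2. R S S\<^sub>2 \<Longrightarrow> step S Tau S' \<Longrightarrow> \<exists>T. taus S\<^sub>2 T \<and> R S' T"
    and "\<And>S a S' S\<^sub>2. R S S\<^sub>2 \<Longrightarrow> step S (Out a) S' \<Longrightarrow> \<exists>T. wstep S\<^sub>2 (Out a) T \<and> R S' T"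
    and "\<And>S a S' S\<^sub>2. R S S\<^sub>2 \<Longrightarrow> step S (In a) S' \<Longrightarrow>
      \<exists>T. taus (S\<^sub>2 \<parallel> ({||}, {#Atom a#})) T \<and> R S' T"
  shows "simulation R"
  unfolding simulation_def compose_Atom
proof (intro allI impI conjI, goal_cases)
  case (3 S\<^sub>1 S\<^sub>2 \<alpha> S\<^sub>1')
  then consider "\<alpha> = Tau" | a where "\<alpha> = Out a" by blast
  then show ?case
  proof cases
    case 1
    then show ?thesis using 3 assms(3)[of S\<^sub>1 S\<^sub>2 S\<^sub>1'] by (simp only: wstep_Tau)
  next
    case (2 a)
    then show ?thesis using 3 assms(4)[of S\<^sub>1 S\<^sub>2 a S\<^sub>1'] by blast
  qed
next
  case (1 S\<^sub>1 S\<^sub>2 \<Gamma>)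
  then show ?case using assms(1) by (simp only: wstep_Tau)
next
  case (2 S\<^sub>1 S\<^sub>2 S S')
  then show ?case using assms(2) by (simp only: wstep_Tau)
next
  case (4 S\<^sub>1 S\<^sub>2 a S\<^sub>1')
  then show ?case using assms(5) by (simp only: wstep_Tau)
qed

lemmas simulationD =
  simulation_def[unfolded compose_Atom, THEN iffD1, rule_format]

lemma sim_leI: "simulation R \<Longrightarrow> R S T \<Longrightarrow> S \<preceq>\<^sub>s T"
  unfolding sim_le_def by (intro exI[of _ R] conjI)

text \<open>Any witnessing simulation lies inside similarity, so similarity may replace it in the
  conclusions of its clauses; the next five lemmas do so.\<close>

lemma sim_le_simulation:
  assumes "S\<^sub>1 \<preceq>\<^sub>s S\<^sub>2"
  shows "\<exists>R. simulation R \<and> R S\<^sub>1 S\<^sub>2 \<and> (\<forall>S T. R S T \<longrightarrow> S \<preceq>\<^sub>s T)"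
proof -
  from assms obtain R where "simulation R" "R S\<^sub>1 S\<^sub>2" unfolding sim_le_def by (elim exE conjE)
  then show ?thesis by (intro exI[of _ R] conjI allI impI sim_leI[of R])
qed

lemma sim_le_empty:
  assumes "(\<Gamma>, {#}) \<preceq>\<^sub>s S\<^sub>2"
  shows "\<exists>\<Gamma>'. taus S\<^sub>2 (\<Gamma>', {#}) \<and> (\<Gamma>, {#}) \<preceq>\<^sub>s (\<Gamma>', {#})"
proof -
  obtain R where R: "simulation R" "R (\<Gamma>, {#}) S\<^sub>2" "\<forall>S T. R S T \<longrightarrow> S \<preceq>\<^sub>s T"
    using sim_le_simulation[OF assms(1)] by blast
  show ?thesis
    using simulationD[OF R(1,2), unfolded wstep_Tau, THEN conjunct1, rule_format, OF refl] R(3)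
    by blast
qed

lemma sim_le_split:
  assumes "S \<parallel> S' \<preceq>\<^sub>s S\<^sub>2"
  shows "\<exists>T T'. taus S\<^sub>2 (T \<parallel> T') \<and> S \<preceq>\<^sub>s T \<and> S' \<preceq>\<^sub>s T'"
proof -
  obtain R where R: "simulation R" "R (S \<parallel> S') S\<^sub>2" "\<forall>S T. R S T \<longrightarrow> S \<preceq>\<^sub>s T"
    using sim_le_simulation[OF assms(1)] by blast
  show ?thesis
    using simulationD[OF R(1,2), unfolded wstep_Tau, THEN conjunct2, THEN conjunct1, rule_format, OF refl] R(3)
    by blast
qed

lemma sim_le_Tau:
  assumes "S \<preceq>\<^sub>s S\<^sub>2" "step S Tau S'"
  shows "\<exists>T. taus S\<^sub>2 T \<and> S' \<preceq>\<^sub>s T"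
proof -
  obtain R where R: "simulation R" "R S S\<^sub>2" "\<forall>S T. R S T \<longrightarrow> S \<preceq>\<^sub>s T"
    using sim_le_simulation[OF assms(1)] by blast
  show ?thesis
    using simulationD[OF R(1,2), THEN conjunct2, THEN conjunct2,
        THEN conjunct1, rule_format, OF _ assms(2)] R(3)
    by (simp only: wstep_Tau) blast
qed

lemma sim_le_Out:
  assumes "S \<preceq>\<^sub>s S\<^sub>2" "step S (Out a) S'"
  shows "\<exists>T. wstep S\<^sub>2 (Out a) T \<and> S' \<preceq>\<^sub>s T"
proof -
  obtain R where R: "simulation R" "R S S\<^sub>2" "\<forall>S T. R S T \<longrightarrow> S \<preceq>\<^sub>s T"
    using sim_le_simulation[OF assms(1)] by blast
  show ?thesis
    using simulationD[OF R(1,2), THEN conjunct2, THEN conjunct2,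
        THEN conjunct1, rule_format, OF _ assms(2)] R(3)
    by blast
qed

lemma sim_le_In:
  assumes "S \<preceq>\<^sub>s S\<^sub>2" "step S (In a) S'"
  shows "\<exists>T. taus (S\<^sub>2 \<parallel> ({||}, {#Atom a#})) T \<and> S' \<preceq>\<^sub>s T"
proof -
  obtain R where R: "simulation R" "R S S\<^sub>2" "\<forall>S T. R S T \<longrightarrow> S \<preceq>\<^sub>s T"
    using sim_le_simulation[OF assms(1)] by blast
  show ?thesis
    using simulationD[OF R(1,2), unfolded wstep_Tau, THEN conjunct2, THEN conjunct2,
        THEN conjunct2, rule_format, OF assms(2)] R(3)
    by blast
qed

section \<open>Closure of similarity under composition\<close>

lemma step_Out_compose_cases:
  assumes "step (S \<parallel> T) (Out a) U"
  obtains (left) S' where "step S (Out a) S'" "U = S' \<parallel> T"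
  | (right) T' where "step T (Out a) T'" "U = S \<parallel> T'"
proof -
  obtain \<Gamma> \<Delta> \<Gamma>\<^sub>T \<Delta>\<^sub>T where S: "S = (\<Gamma>, \<Delta>)" and T: "T = (\<Gamma>\<^sub>T, \<Delta>\<^sub>T)"
    by (cases S, cases T)
  with assms obtain K where K: "\<Delta> + \<Delta>\<^sub>T = add_mset (Atom a) K" "U = (\<Gamma> |\<union>| \<Gamma>\<^sub>T, K)"
    by (auto simp: step_Out_iff)
  then have "Atom a \<in># \<Delta> \<or> Atom a \<in># \<Delta>\<^sub>T" by (metis union_iff union_single_eq_member)
  then show thesis
    using K left[of "(\<Gamma>, \<Delta> - {#Atom a#})"] right[of "(\<Gamma>\<^sub>T, \<Delta>\<^sub>T - {#Atom a#})"]
    by (auto simp: S T step_Out_iff dest!: multi_member_split)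
qed

lemma step_In_compose_cases:
  assumes "step (S \<parallel> T) (In a) U"
  obtains (left) S' where "step S (In a) S'" "U = S' \<parallel> T"
  | (right) T' where "step T (In a) T'" "U = S \<parallel> T'"
proof -
  obtain \<Gamma> \<Delta> \<Gamma>\<^sub>T \<Delta>\<^sub>T where S: "S = (\<Gamma>, \<Delta>)" and T: "T = (\<Gamma>\<^sub>T, \<Delta>\<^sub>T)"
    by (cases S, cases T)
  with assms obtain K B where K: "\<Delta> + \<Delta>\<^sub>T = add_mset (a \<multimap> B) K"
    "U = (\<Gamma> |\<union>| \<Gamma>\<^sub>T, add_mset B K)"
    by (auto simp: step_In_iff)
  then have "a \<multimap> B \<in># \<Delta> \<or> a \<multimap> B \<in># \<Delta>\<^sub>T" by (metis union_iff union_single_eq_member)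
  then show thesis
    using K left[of "(\<Gamma>, \<Delta> - {#a \<multimap> B#} + {#B#})"]
      right[of "(\<Gamma>\<^sub>T, \<Delta>\<^sub>T - {#a \<multimap> B#} + {#B#})"]
    by (auto simp: S T step_In dest!: multi_member_split)
qed

lemma compose_assoc: "(S \<parallel> T) \<parallel> U = S \<parallel> (T \<parallel> U)"
  by (simp add: compose_def ac_simps sup.assoc)

lemma compose_left_commute: "S \<parallel> (T \<parallel> U) = T \<parallel> (S \<parallel> U)"
  by (metis compose_assoc compose_commute)

lemmas compose_ac = compose_assoc compose_commute compose_left_commute

lemma step_Out_compose: "step T (Out a) T' \<Longrightarrow> T = T' \<parallel> ({||}, {#Atom a#})"
  by (cases T) (auto simp: step_Out_iff)

text \<open>The waiting implication communicates with the added atom, which produces the silent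
  answer demanded by the input clause.\<close>

lemma step_In_atom: "step T (In a) T' \<Longrightarrow> step (T \<parallel> ({||}, {#Atom a#})) Tau T'"
  by (cases T) (auto simp: step_In_iff intro: step_comm)

text \<open>Similar states composed with a common partner form a simulation: steps of the partner
  are copied, steps of the first component are answered by similarity, and communications are
  reassembled from both.\<close>

lemma sim_le_compose:
  assumes "S\<^sub>1 \<preceq>\<^sub>s S\<^sub>2"
  shows "S\<^sub>1 \<parallel> T \<preceq>\<^sub>s S\<^sub>2 \<parallel> T"
proof -
  define R :: "'a state \<Rightarrow> 'a state \<Rightarrow> bool"
    where "R U V \<longleftrightarrow> (\<exists>S\<^sub>1 S\<^sub>2 T. U = S\<^sub>1 \<parallel> T \<and> V = S\<^sub>2 \<parallel> T \<and> S\<^sub>1 \<preceq>\<^sub>s S\<^sub>2)" for U V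
  have RI: "S\<^sub>1 \<preceq>\<^sub>s S\<^sub>2 \<Longrightarrow> R (S\<^sub>1 \<parallel> T) (S\<^sub>2 \<parallel> T)" for S\<^sub>1 S\<^sub>2 T
    unfolding R_def by blast
  have "simulation R"
  proof (rule simulationI)
    fix \<Gamma> V assume "R (\<Gamma>, {#}) V"
    then obtain S\<^sub>1 S\<^sub>2 T where *: "(\<Gamma>, {#}) = S\<^sub>1 \<parallel> T" "V = S\<^sub>2 \<parallel> T" "S\<^sub>1 \<preceq>\<^sub>s S\<^sub>2"
      unfolding R_def by blast
    then obtain \<Gamma>\<^sub>1 \<Gamma>\<^sub>T where st: "S\<^sub>1 = (\<Gamma>\<^sub>1, {#})" "T = (\<Gamma>\<^sub>T, {#})" "\<Gamma> = \<Gamma>\<^sub>1 |\<union>| \<Gamma>\<^sub>T"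
      by (cases S\<^sub>1, cases T) auto
    from sim_le_empty *(3) st(1) obtain \<Gamma>' where
      \<Gamma>': "taus S\<^sub>2 (\<Gamma>', {#})" "S\<^sub>1 \<preceq>\<^sub>s (\<Gamma>', {#})" by blast
    have "taus V (\<Gamma>' |\<union>| \<Gamma>\<^sub>T, {#})" using taus_compose[OF \<Gamma>'(1), of T] * st by simp
    moreover have "R (\<Gamma>, {#}) (\<Gamma>' |\<union>| \<Gamma>\<^sub>T, {#})" using RI[OF \<Gamma>'(2), of T] st by simp
    ultimately show "\<exists>\<Gamma>'. taus V (\<Gamma>', {#}) \<and> R (\<Gamma>, {#}) (\<Gamma>', {#})" by blast
  next
    fix U U' V assume "R (U \<parallel> U') V"
    then obtain S\<^sub>1 S\<^sub>2 T where *: "S\<^sub>1 \<parallel> T = U \<parallel> U'" "V = S\<^sub>2 \<parallel> T" "S\<^sub>1 \<preceq>\<^sub>s S\<^sub>2"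
      unfolding R_def by metis
    \<comment> \<open>The given splitting may cut across both components. Similarity splits the
      first one accordingly; the partner is cut literally.\<close>
    from *(1) obtain S S' T\<^sub>1 T\<^sub>2
      where st: "S\<^sub>1 = S \<parallel> S'" "T = T\<^sub>1 \<parallel> T\<^sub>2" "U = S \<parallel> T\<^sub>1" "U' = S' \<parallel> T\<^sub>2"
      by (rule compose_refinement)
    from sim_le_split *(3) st(1) obtain W W'
      where W: "taus S\<^sub>2 (W \<parallel> W')" "S \<preceq>\<^sub>s W" "S' \<preceq>\<^sub>s W'" by blast
    have "taus V ((W \<parallel> T\<^sub>1) \<parallel> (W' \<parallel> T\<^sub>2))"
      using taus_compose[OF W(1), of T] by (simp add: * st compose_ac)
    then show "\<exists>T T'. taus V (T \<parallel> T') \<and> R U T \<and> R U' T'" using RI W st by blast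
  next
    fix U U' V assume "R U V" and step: "step U Tau U'"
    then obtain S\<^sub>1 S\<^sub>2 T where *: "U = S\<^sub>1 \<parallel> T" "V = S\<^sub>2 \<parallel> T" "S\<^sub>1 \<preceq>\<^sub>s S\<^sub>2"
      unfolding R_def by blast
    from step[unfolded *(1)] show "\<exists>W. taus V W \<and> R U' W"
    proof (cases rule: step_Tau_compose_cases)
      case (left S')
      then show ?thesis using sim_le_Tau[OF *(3)] RI taus_compose *(2) by blast
    next
      case (right T')
      then have "step V Tau (S\<^sub>2 \<parallel> T')" by (metis *(2) compose_commute step_compose)
      then show ?thesis using right RI[OF *(3)] by blast
    next
      case (left_right a S' T')
      then obtain X X' W where W: "taus S\<^sub>2 X" "step X (Out a) X'" "taus X' W" "S' \<preceq>\<^sub>s W"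
        using sim_le_Out[OF *(3)] unfolding wstep_Out by blast
      \<comment> \<open>The simulating component outputs in the middle of a silent run, and there
        the communication takes place.\<close>
      have "step (X \<parallel> T) Tau (X' \<parallel> T')" using W(2) left_right(2) by (rule step.comm)
      then have "taus V (W \<parallel> T')"
        unfolding *(2) using taus_compose[OF W(1), of T] taus_compose[OF W(3), of T']
          converse_rtranclp_into_rtranclp[of "\<lambda>S S'. step S Tau S'"] rtranclp_trans by metis
      then show ?thesis using RI W(4) left_right(3) by blast
    next
      case (right_left a S' T')
      then obtain W where W: "taus (S\<^sub>2 \<parallel> ({||}, {#Atom a#})) W" "S' \<preceq>\<^sub>s W"
        using sim_le_In[OF *(3)] by blast
      \<comment> \<open>The input clause hands \<open>S\<^sub>2\<close> the atom in advance. Here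
        the partner supplies it, as its output merely drops that atom.\<close>
      have "V = (S\<^sub>2 \<parallel> ({||}, {#Atom a#})) \<parallel> T'"
        using step_Out_compose[OF right_left(2)] by (metis *(2) compose_assoc compose_commute)
      then show ?thesis using W RI right_left(3) taus_compose by blast
    qed
  next
    fix U a U' V assume "R U V" and step: "step U (Out a) U'"
    then obtain S\<^sub>1 S\<^sub>2 T where *: "U = S\<^sub>1 \<parallel> T" "V = S\<^sub>2 \<parallel> T" "S\<^sub>1 \<preceq>\<^sub>s S\<^sub>2"
      unfolding R_def by blast
    from step[unfolded *(1)] show "\<exists>W. wstep V (Out a) W \<and> R U' W"
    proof (cases rule: step_Out_compose_cases)
      case (left S')
      then obtain X X' W where W: "taus S\<^sub>2 X" "step X (Out a) X'" "taus X' W" "S' \<preceq>\<^sub>s W"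
        using sim_le_Out[OF *(3)] unfolding wstep_Out by blast
      then have "wstep V (Out a) (W \<parallel> T)"
        unfolding *(2) wstep_Out using taus_compose step_compose by blast
      then show ?thesis using W RI left by blast
    next
      case (right T')
      then have "step V (Out a) (S\<^sub>2 \<parallel> T')" by (metis *(2) compose_commute step_compose)
      then show ?thesis using right RI[OF *(3)] by (metis rtranclp.rtrancl_refl wstep_Out)
    qed
  next
    fix U a U' V assume "R U V" and step: "step U (In a) U'"
    then obtain S\<^sub>1 S\<^sub>2 T where *: "U = S\<^sub>1 \<parallel> T" "V = S\<^sub>2 \<parallel> T" "S\<^sub>1 \<preceq>\<^sub>s S\<^sub>2"
      unfolding R_def by blast
    from step[unfolded *(1)] show "\<exists>W. taus (V \<parallel> ({||}, {#Atom a#})) W \<and> R U' W"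
    proof (cases rule: step_In_compose_cases)
      case (left S')
      then obtain W where W: "taus (S\<^sub>2 \<parallel> ({||}, {#Atom a#})) W" "S' \<preceq>\<^sub>s W"
        using sim_le_In[OF *(3)] by blast
      have "V \<parallel> ({||}, {#Atom a#}) = (S\<^sub>2 \<parallel> ({||}, {#Atom a#})) \<parallel> T"
        by (metis *(2) compose_assoc compose_commute)
      then have "taus (V \<parallel> ({||}, {#Atom a#})) (W \<parallel> T)" using taus_compose[OF W(1)] by metis
      then show ?thesis using RI[OF W(2)] left by blast
    next
      case (right T')
      \<comment> \<open>The partner holds the implication, so it consumes the added atom while
        \<open>S\<^sub>2\<close> stays put.\<close>
      have "V \<parallel> ({||}, {#Atom a#}) = (T \<parallel> ({||}, {#Atom a#})) \<parallel> S\<^sub>2"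
        by (metis *(2) compose_assoc compose_commute)
      then have "step (V \<parallel> ({||}, {#Atom a#})) Tau (S\<^sub>2 \<parallel> T')"
        using step_compose[OF step_In_atom[OF right(1)], of S\<^sub>2] by (metis compose_commute)
      then show ?thesis using RI[OF *(3)] right by blast
    qed
  qed
  then show ?thesis using RI[OF assms] by (rule sim_leI)
qed

text \<open>Rules of entailment are matched by features of similarity: \<open>tau\<close> by the
  silent clause, \<open>tensor\<close> by splitting, \<open>one\<close> and \<open>bang\<close> by
  the empty clause, \<open>lolli\<close> by closure under composition, \<open>atom\<close> by output
  followed by the empty clause.\<close>

lemma sim_le_entails:
  assumes "S \<tturnstile> C" "S \<preceq>\<^sub>s S\<^sub>2"
  shows "S\<^sub>2 \<tturnstile> C"
  using assms
proof (induction arbitrary: S\<^sub>2)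
  case (tau S S' C)
  then show ?case by (meson entails_taus sim_le_Tau)
next
  case (atom \<Gamma> a)
  have "step (\<Gamma>, {#Atom a#}) (Out a) (\<Gamma>, {#})" by (simp add: step_Out_iff)
  then obtain X X' W where W: "taus S\<^sub>2 X" "step X (Out a) X'" "taus X' W" "(\<Gamma>, {#}) \<preceq>\<^sub>s W"
    using sim_le_Out[OF atom, of a "(\<Gamma>, {#})"] unfolding wstep_Out by blast
  obtain \<Gamma>' where "taus W (\<Gamma>', {#})" using sim_le_empty[OF W(4)] by blast
  with W(3) have "taus X' (\<Gamma>', {#})" by (rule rtranclp_trans)
  \<comment> \<open>Instead of being emitted, the atom is kept as a frame while the remainder of X
    runs to an empty linear context.\<close>
  then have "taus X ((\<Gamma>', {#}) \<parallel> ({||}, {#Atom a#}))"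
    using step_Out_compose[OF W(2)] taus_compose by metis
  then have "taus S\<^sub>2 (\<Gamma>', {#Atom a#})" using W(1) by simp
  then show ?case by (auto intro: entails_taus entails.atom)
next
  case (tensor \<Gamma> \<Delta>\<^sub>1 A \<Delta>\<^sub>2 B)
  have "(\<Gamma>, \<Delta>\<^sub>1) \<parallel> (\<Gamma>, \<Delta>\<^sub>2) \<preceq>\<^sub>s S\<^sub>2" using tensor.prems by simp
  then obtain T T' where T: "taus S\<^sub>2 (T \<parallel> T')" "(\<Gamma>, \<Delta>\<^sub>1) \<preceq>\<^sub>s T" "(\<Gamma>, \<Delta>\<^sub>2) \<preceq>\<^sub>s T'"
    using sim_le_split by blast
  obtain \<Gamma>\<^sub>1 D\<^sub>1 \<Gamma>\<^sub>2 D\<^sub>2 where st: "T = (\<Gamma>\<^sub>1, D\<^sub>1)" "T' = (\<Gamma>\<^sub>2, D\<^sub>2)" by (cases T, cases T')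
  \<comment> \<open>The halves may have different persistent contexts, whereas
    \<open>entails.tensor\<close> needs a shared one; weakening brings both to the union.\<close>
  have "(\<Gamma>\<^sub>1 |\<union>| \<Gamma>\<^sub>2, D\<^sub>1) \<tturnstile> A" "(\<Gamma>\<^sub>1 |\<union>| \<Gamma>\<^sub>2, D\<^sub>2) \<tturnstile> B"
    using entails_mono[OF tensor.IH(1)[OF T(2), unfolded st], of "\<Gamma>\<^sub>1 |\<union>| \<Gamma>\<^sub>2"]
      entails_mono[OF tensor.IH(2)[OF T(3), unfolded st], of "\<Gamma>\<^sub>1 |\<union>| \<Gamma>\<^sub>2"] by simp_all
  then have "T \<parallel> T' \<tturnstile> A \<otimes> B" using st entails.tensor by simp
  then show ?case using T(1) entails_taus by blast
next
  case (one \<Gamma>)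
  then show ?case by (meson entails.one entails_taus sim_le_empty)
next
  case (lolli \<Gamma> a \<Delta> B)
  obtain \<Gamma>\<^sub>2 \<Delta>\<^sub>2 where S\<^sub>2: "S\<^sub>2 = (\<Gamma>\<^sub>2, \<Delta>\<^sub>2)" by (cases S\<^sub>2)
  have "(\<Gamma>, add_mset (Atom a) \<Delta>) \<preceq>\<^sub>s (\<Gamma>\<^sub>2, add_mset (Atom a) \<Delta>\<^sub>2)"
    using sim_le_compose[OF lolli.prems, of "({||}, {#Atom a#})"] by (simp add: S\<^sub>2)
  then show ?case unfolding S\<^sub>2 by (intro entails.lolli lolli.IH)
next
  case (bang \<Gamma> A)
  then show ?case by (meson entails.bang entails_taus sim_le_empty)
qed (auto intro: entails_right_intros)

section \<open>The logical preorder implies similarity\<close>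

text \<open>Each formula of the second multiset owns a piece of the first, while \<Gamma> is shared.
  This is what repeated inversion of a tensor delivers, without an order on the factors.\<close>

inductive entails_all :: "'a form fset \<Rightarrow> 'a form multiset \<Rightarrow> 'a form multiset \<Rightarrow> bool"
  for \<Gamma> where
  empty: "entails_all \<Gamma> {#} {#}"
| add: "(\<Gamma>, D) \<tturnstile> A \<Longrightarrow> entails_all \<Gamma> \<Delta> M \<Longrightarrow> entails_all \<Gamma> (D + \<Delta>) (add_mset A M)"

lemma entails_all_emptyD: "entails_all \<Gamma> \<Delta> {#} \<Longrightarrow> \<Delta> = {#}"
  by (auto elim: entails_all.cases)

text \<open>The last use of \<open>add\<close> may concern another occurrence; its piece is then set
  aside and put back onto the remainder.\<close>

lemma entails_all_addD:
  assumes "entails_all \<Gamma> \<Delta> (add_mset A M)"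
  obtains D \<Delta>' where "\<Delta> = D + \<Delta>'" "(\<Gamma>, D) \<tturnstile> A" "entails_all \<Gamma> \<Delta>' M"
proof -
  from assms have "\<exists>D \<Delta>'. \<Delta> = D + \<Delta>' \<and> (\<Gamma>, D) \<tturnstile> A \<and> entails_all \<Gamma> \<Delta>' M"
  proof (induction \<Delta> "add_mset A M" arbitrary: M)
    case empty
    then show ?case by simp
  next
    case (add D A' \<Delta> M')
    show ?case
    proof (cases "A' = A")
      case True
      then show ?thesis using add by auto
    next
      case False
      then obtain K where K: "M' = add_mset A K" "M = add_mset A' K"
        using add.hyps(4) by (metis add_eq_conv_ex)
      then obtain D' \<Delta>' where "\<Delta> = D' + \<Delta>'" "(\<Gamma>, D') \<tturnstile> A" "entails_all \<Gamma> \<Delta>' K"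
        using add.hyps(3) by blast
      then show ?thesis
        using K entails_all.add[OF add.hyps(1)]
        by (intro exI[of _ D'] exI[of _ "D + \<Delta>'"]) (simp add: add.left_commute)
    qed
  qed
  then show thesis using that by blast
qed

lemma entails_all_unionD:
  assumes "entails_all \<Gamma> \<Delta> (M + N)"
  obtains \<Delta>\<^sub>1 \<Delta>\<^sub>2 where "\<Delta> = \<Delta>\<^sub>1 + \<Delta>\<^sub>2" "entails_all \<Gamma> \<Delta>\<^sub>1 M" "entails_all \<Gamma> \<Delta>\<^sub>2 N"
proof -
  from assms have "\<exists>\<Delta>\<^sub>1 \<Delta>\<^sub>2. \<Delta> = \<Delta>\<^sub>1 + \<Delta>\<^sub>2 \<and> entails_all \<Gamma> \<Delta>\<^sub>1 M \<and> entails_all \<Gamma> \<Delta>\<^sub>2 N"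
  proof (induction M arbitrary: \<Delta>)
    case empty
    then show ?case by (intro exI[of _ "{#}"] exI[of _ \<Delta>]) (simp add: entails_all.empty)
  next
    case (add A M)
    then obtain D \<Delta>' where D: "\<Delta> = D + \<Delta>'" "(\<Gamma>, D) \<tturnstile> A" "entails_all \<Gamma> \<Delta>' (M + N)"
      by (auto elim: entails_all_addD)
    with add.IH obtain \<Delta>\<^sub>1 \<Delta>\<^sub>2
      where "\<Delta>' = \<Delta>\<^sub>1 + \<Delta>\<^sub>2" "entails_all \<Gamma> \<Delta>\<^sub>1 M" "entails_all \<Gamma> \<Delta>\<^sub>2 N" by blast
    then show ?case
      using D(1) entails_all.add[OF D(2)]
      by (intro exI[of _ "D + \<Delta>\<^sub>1"] exI[of _ \<Delta>\<^sub>2]) (simp add: add.assoc)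
  qed
  then show thesis using that by blast
qed

lemma entails_all_mono: "entails_all \<Gamma> \<Delta> M \<Longrightarrow> \<Gamma> |\<subseteq>| \<Gamma>' \<Longrightarrow> entails_all \<Gamma>' \<Delta> M"
  by (induction rule: entails_all.induct) (auto intro: entails_all.intros entails_mono)

text \<open>Persistent formulas are to be entailed without linear resources, since they can be
  copied at will. The silent run in front absorbs the steps after which inversion exposes the
  pieces.\<close>

definition covers :: "'a state \<Rightarrow> 'a state \<Rightarrow> bool" where
  "covers S\<^sub>1 S\<^sub>2 \<longleftrightarrow> (\<exists>\<Gamma> \<Delta>. taus S\<^sub>2 (\<Gamma>, \<Delta>) \<and> entails_all \<Gamma> \<Delta> (snd S\<^sub>1) \<and>
    (\<forall>B. B |\<in>| fst S\<^sub>1 \<longrightarrow> (\<Gamma>, {#}) \<tturnstile> B))"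

lemma coversI:
  "entails_all \<Gamma> \<Delta> M \<Longrightarrow> (\<And>B. B |\<in>| \<Gamma>\<^sub>1 \<Longrightarrow> (\<Gamma>, {#}) \<tturnstile> B) \<Longrightarrow> covers (\<Gamma>\<^sub>1, M) (\<Gamma>, \<Delta>)"
  by (auto simp: covers_def)

text \<open>Only the pieces owned by the formulas taking part in the step react, and inversion of
  their entailments supplies the reaction.\<close>

lemma covers_step_Tau:
  assumes all: "entails_all \<Gamma> \<Delta> M" and pers: "\<And>B. B |\<in>| \<Gamma>\<^sub>1 \<Longrightarrow> (\<Gamma>, {#}) \<tturnstile> B"
    and step: "step (\<Gamma>\<^sub>1, M) Tau U"
  shows "\<exists>V. taus (\<Gamma>, \<Delta>) V \<and> covers U V"
  using step
proof (cases rule: step_Tau_cases)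
  case (unfold F M\<^sub>0 N)
  with all obtain D \<Delta>' where D: "\<Delta> = D + \<Delta>'" "(\<Gamma>, D) \<tturnstile> F" and \<Delta>': "entails_all \<Gamma> \<Delta>' M\<^sub>0"
    by (auto elim: entails_all_addD)
  \<comment> \<open>Common pattern for unfolding: the piece D runs, the other pieces are a frame,
    and only newly persistent formulas need a fresh entailment.\<close>
  have reach: ?thesis
    if taus: "taus (\<Gamma>, D) (\<Gamma>', D')" and "entails_all \<Gamma>' (D' + \<Delta>') (snd U)"
      and "\<And>B. B |\<in>| fst U \<Longrightarrow> B |\<notin>| \<Gamma>\<^sub>1 \<Longrightarrow> (\<Gamma>', {#}) \<tturnstile> B" for \<Gamma>' D'
  proof -
    have "\<Gamma> |\<subseteq>| \<Gamma>'" using taus_persistent_mono[OF taus] by simp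
    then have "covers U (\<Gamma>', D' + \<Delta>')"
      using that(2,3) pers by (cases U) (auto intro!: coversI intro: entails_mono)
    then show ?thesis using taus_add[OF taus, of \<Delta>'] D(1) by blast
  qed
  have mono: "entails_all \<Gamma>' \<Delta>' M\<^sub>0" if "taus (\<Gamma>, D) (\<Gamma>', D')" for \<Gamma>' D'
    using entails_all_mono[OF \<Delta>'] taus_persistent_mono[OF that] by simp
  show ?thesis using unfold(2)
  proof cases
    case (1 A B)
    then obtain \<Gamma>' D\<^sub>1 D\<^sub>2
      where *: "taus (\<Gamma>, D) (\<Gamma>', D\<^sub>1 + D\<^sub>2)" "(\<Gamma>', D\<^sub>1) \<tturnstile> A" "(\<Gamma>', D\<^sub>2) \<tturnstile> B"
      using D(2) by (auto elim: entails_Tensor)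
    then show ?thesis
      using entails_all.add[OF *(2) entails_all.add[OF *(3) mono[OF *(1)]]] unfold(3) 1
      by (intro reach[OF *(1)]) (auto simp: add.assoc)
  next
    case 2
    then obtain \<Gamma>' where *: "taus (\<Gamma>, D) (\<Gamma>', {#})" using D(2) by (auto elim: entails_One)
    then show ?thesis
      using mono[OF *] unfold(3) 2 by (intro reach[OF *]) auto
  next
    case (3 A B)
    \<comment> \<open>The same piece entails the chosen component, so the answer is the empty
      run.\<close>
    then have "(\<Gamma>, D) \<tturnstile> A" using D(2) entails_With by blast
    then show ?thesis
      using entails_all.add[OF _ \<Delta>'] unfold(3) 3 by (intro reach[of \<Gamma> D]) auto
  next
    case (4 A B)
    then have "(\<Gamma>, D) \<tturnstile> B" using D(2) entails_With by blast
    then show ?thesis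
      using entails_all.add[OF _ \<Delta>'] unfold(3) 4 by (intro reach[of \<Gamma> D]) auto
  next
    case (5 A)
    then obtain \<Gamma>' where *: "taus (\<Gamma>, D) (\<Gamma>', {#})" "(\<Gamma>', {#}) \<tturnstile> A"
      using D(2) by (auto elim: entails_Bang)
    then show ?thesis
      using mono[OF *(1)] unfold(3) 5 by (intro reach[OF *(1)]) auto
  qed
next
  case (copy A)
  \<comment> \<open>The new linear copy of A is covered by an empty piece.\<close>
  then have "covers U (\<Gamma>, \<Delta>)"
    using entails_all.add[OF pers all] pers by (auto intro!: coversI)
  then show ?thesis by blast
next
  case (comm a B M\<^sub>0)
  with all obtain D \<Delta>' where D: "\<Delta> = D + \<Delta>'" "(\<Gamma>, D) \<tturnstile> Atom a"
    and "entails_all \<Gamma> \<Delta>' (add_mset (a \<multimap> B) M\<^sub>0)"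
    by (auto elim: entails_all_addD)
  then obtain E \<Delta>'' where E: "\<Delta>' = E + \<Delta>''" "(\<Gamma>, E) \<tturnstile> a \<multimap> B" "entails_all \<Gamma> \<Delta>'' M\<^sub>0"
    by (auto elim: entails_all_addD)
  \<comment> \<open>D runs down to the bare atom, which joins the piece E of the implication. The
    communication is not performed but absorbed into the entailment of B.\<close>
  obtain \<Gamma>' where \<Gamma>': "taus (\<Gamma>, D) (\<Gamma>', {#Atom a#})" using D(2) by (rule entails_Atom)
  have sub: "\<Gamma> |\<subseteq>| \<Gamma>'" using taus_persistent_mono[OF \<Gamma>'] by simp
  have "(\<Gamma>', E + {#Atom a#}) \<tturnstile> B" using entails_Lolli[OF E(2)] sub by (auto intro: entails_mono)
  then have "entails_all \<Gamma>' (E + {#Atom a#} + \<Delta>'') (add_mset B M\<^sub>0)"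
    using entails_all_mono[OF E(3) sub] by (rule entails_all.add)
  then have "covers U (\<Gamma>', {#Atom a#} + \<Delta>')"
    using pers sub comm(2) E(1) by (auto intro!: coversI intro: entails_mono)
  then show ?thesis using taus_add[OF \<Gamma>', of \<Delta>'] D(1) by blast
qed

lemma simulation_covers: "simulation covers"
proof (rule simulationI)
  fix \<Gamma>\<^sub>1 and V :: "'a state" assume "covers (\<Gamma>\<^sub>1, {#}) V"
  then obtain \<Gamma> where "taus V (\<Gamma>, {#})" "\<forall>B. B |\<in>| \<Gamma>\<^sub>1 \<longrightarrow> (\<Gamma>, {#}) \<tturnstile> B"
    by (auto simp: covers_def dest: entails_all_emptyD)
  then show "\<exists>\<Gamma>'. taus V (\<Gamma>', {#}) \<and> covers (\<Gamma>\<^sub>1, {#}) (\<Gamma>', {#})"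
    by (auto intro: coversI entails_all.empty)
next
  fix S S' V :: "'a state" assume "covers (S \<parallel> S') V"
  moreover obtain \<Gamma>\<^sub>1 M \<Gamma>\<^sub>1' M' where S: "S = (\<Gamma>\<^sub>1, M)" "S' = (\<Gamma>\<^sub>1', M')" by (cases S, cases S')
  ultimately obtain \<Gamma> \<Delta> where *: "taus V (\<Gamma>, \<Delta>)" "entails_all \<Gamma> \<Delta> (M + M')"
    "\<forall>B. B |\<in>| \<Gamma>\<^sub>1 |\<union>| \<Gamma>\<^sub>1' \<longrightarrow> (\<Gamma>, {#}) \<tturnstile> B"
    by (auto simp: covers_def)
  from *(2) obtain \<Delta>\<^sub>1 \<Delta>\<^sub>2 where \<Delta>: "\<Delta> = \<Delta>\<^sub>1 + \<Delta>\<^sub>2" "entails_all \<Gamma> \<Delta>\<^sub>1 M" "entails_all \<Gamma> \<Delta>\<^sub>2 M'"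
    by (rule entails_all_unionD)
  \<comment> \<open>Both parts keep all of \<Gamma>, and their union gives \<Gamma> back.\<close>
  have "taus V ((\<Gamma>, \<Delta>\<^sub>1) \<parallel> (\<Gamma>, \<Delta>\<^sub>2))" using * \<Delta> by simp
  moreover have "covers S (\<Gamma>, \<Delta>\<^sub>1)" "covers S' (\<Gamma>, \<Delta>\<^sub>2)" using * \<Delta> S by (auto intro: coversI)
  ultimately show "\<exists>T T'. taus V (T \<parallel> T') \<and> covers S T \<and> covers S' T'" by blast
next
  fix S U V :: "'a state" assume "covers S V" and step: "step S Tau U"
  then obtain \<Gamma> \<Delta> where V: "taus V (\<Gamma>, \<Delta>)" "entails_all \<Gamma> \<Delta> (snd S)"
    "\<And>B. B |\<in>| fst S \<Longrightarrow> (\<Gamma>, {#}) \<tturnstile> B"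
    unfolding covers_def by blast
  obtain T where "taus (\<Gamma>, \<Delta>) T" "covers U T"
    using covers_step_Tau[OF V(2,3), of "fst S" U] step by auto
  then show "\<exists>T. taus V T \<and> covers U T" using V(1) by (meson rtranclp_trans)
next
  fix S U V :: "'a state" and a assume "covers S V" "step S (Out a) U"
  then obtain \<Gamma>\<^sub>1 M \<Gamma> \<Delta> where S: "S = (\<Gamma>\<^sub>1, add_mset (Atom a) M)" "U = (\<Gamma>\<^sub>1, M)"
    and V: "taus V (\<Gamma>, \<Delta>)" "entails_all \<Gamma> \<Delta> (add_mset (Atom a) M)"
      "\<forall>B. B |\<in>| \<Gamma>\<^sub>1 \<longrightarrow> (\<Gamma>, {#}) \<tturnstile> B"
    by (cases S) (auto simp: covers_def step_Out_iff)
  from V(2) obtain D \<Delta>' where D: "\<Delta> = D + \<Delta>'" "(\<Gamma>, D) \<tturnstile> Atom a" "entails_all \<Gamma> \<Delta>' M"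
    by (rule entails_all_addD)
  \<comment> \<open>The piece owned by the atom runs to the bare atom, which can then be
    emitted.\<close>
  obtain \<Gamma>' where \<Gamma>': "taus (\<Gamma>, D) (\<Gamma>', {#Atom a#})" using D(2) by (rule entails_Atom)
  have sub: "\<Gamma> |\<subseteq>| \<Gamma>'" using taus_persistent_mono[OF \<Gamma>'] by simp
  have "taus V (\<Gamma>', {#Atom a#} + \<Delta>')"
    using V(1) taus_add[OF \<Gamma>', of \<Delta>'] D(1) by (meson rtranclp_trans)
  then have "wstep V (Out a) (\<Gamma>', \<Delta>')"
    unfolding wstep_Out by (metis add_mset_add_single rtranclp.rtrancl_refl step_Out_iff union_commute)
  moreover have "covers U (\<Gamma>', \<Delta>')"
    using S(2) V(3) entails_all_mono[OF D(3) sub] sub by (auto intro!: coversI intro: entails_mono)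
  ultimately show "\<exists>T. wstep V (Out a) T \<and> covers U T" by blast
next
  fix S U V :: "'a state" and a assume "covers S V" "step S (In a) U"
  then obtain \<Gamma>\<^sub>1 M \<Gamma> \<Delta> B where S: "S = (\<Gamma>\<^sub>1, add_mset (a \<multimap> B) M)" "U = (\<Gamma>\<^sub>1, add_mset B M)"
    and V: "taus V (\<Gamma>, \<Delta>)" "entails_all \<Gamma> \<Delta> (add_mset (a \<multimap> B) M)"
      "\<forall>B. B |\<in>| \<Gamma>\<^sub>1 \<longrightarrow> (\<Gamma>, {#}) \<tturnstile> B"
    by (cases S) (auto simp: covers_def step_In_iff)
  from V(2) obtain D \<Delta>' where D: "\<Delta> = D + \<Delta>'" "(\<Gamma>, D) \<tturnstile> a \<multimap> B" "entails_all \<Gamma> \<Delta>' M"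
    by (rule entails_all_addD)
  \<comment> \<open>The received atom is added to the piece of the implication.\<close>
  have "(\<Gamma>, D + {#Atom a#}) \<tturnstile> B" using entails_Lolli[OF D(2)] by simp
  then have "covers U (\<Gamma>, \<Delta> + {#Atom a#})"
    using S(2) V(3) entails_all.add[OF _ D(3)] D(1) by (fastforce intro: coversI)
  moreover have "taus (V \<parallel> ({||}, {#Atom a#})) (\<Gamma>, \<Delta> + {#Atom a#})"
    using taus_compose[OF V(1), of "({||}, {#Atom a#})"] by simp
  ultimately show "\<exists>T. taus (V \<parallel> ({||}, {#Atom a#})) T \<and> covers U T" by blast
qed

section \<open>From inclusion of entailed formulas to covering\<close>

definition tensor_list :: "'a form list \<Rightarrow> 'a form" where
  "tensor_list As = foldr Tensor As One"

lemma entails_tensor_list: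
  assumes "entails_all \<Gamma> \<Delta> (mset As)"
  shows "(\<Gamma>, \<Delta>) \<tturnstile> tensor_list As"
  using assms
proof (induction As arbitrary: \<Delta>)
  case Nil
  then show ?case by (auto simp: tensor_list_def intro: entails.one dest: entails_all_emptyD)
next
  case (Cons A As)
  then show ?case
    by (auto simp: tensor_list_def elim!: entails_all_addD intro: entails.tensor)
qed

text \<open>The tensors are inverted one after another. Later inversions may enlarge the persistent
  context, and \<open>entails_mono\<close> carries along the pieces already found.\<close>

lemma tensor_list_entails_all:
  assumes "S \<tturnstile> tensor_list As"
  shows "\<exists>\<Gamma> \<Delta>. taus S (\<Gamma>, \<Delta>) \<and> entails_all \<Gamma> \<Delta> (mset As)"
  using assms
proof (induction As arbitrary: S)
  case Nil
  then show ?case by (auto simp: tensor_list_def elim!: entails_One intro: entails_all.empty)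
next
  case (Cons A As)
  then have "S \<tturnstile> A \<otimes> tensor_list As" by (simp add: tensor_list_def)
  then obtain \<Gamma> D \<Delta> where 1: "taus S (\<Gamma>, D + \<Delta>)" "(\<Gamma>, D) \<tturnstile> A" "(\<Gamma>, \<Delta>) \<tturnstile> tensor_list As"
    by (rule entails_Tensor)
  from Cons.IH[OF 1(3)] obtain \<Gamma>' \<Delta>'
    where 2: "taus (\<Gamma>, \<Delta>) (\<Gamma>', \<Delta>')" "entails_all \<Gamma>' \<Delta>' (mset As)" by blast
  have "\<Gamma> |\<subseteq>| \<Gamma>'" using taus_persistent_mono[OF 2(1)] by simp
  then have "entails_all \<Gamma>' (D + \<Delta>') (mset (A # As))"
    using 1(2) 2(2) by (auto intro: entails_all.add entails_mono)
  moreover have "taus S (\<Gamma>', D + \<Delta>')"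
    using 1(1) taus_add[OF 2(1), of D] by (simp add: add.commute[of D])
  ultimately show ?case by blast
qed

text \<open>Inverting \<open>Bang\<close> uses up its whole linear piece, so nothing linear is left
  once all pieces have run, while the persistent context accumulates what entails every B.\<close>

lemma entails_all_Bang:
  assumes "entails_all \<Gamma> \<Delta> (mset (map Bang Bs))"
  shows "\<exists>\<Gamma>'. taus (\<Gamma>, \<Delta>) (\<Gamma>', {#}) \<and> (\<forall>B\<in>set Bs. (\<Gamma>', {#}) \<tturnstile> B)"
  using assms
proof (induction Bs arbitrary: \<Gamma> \<Delta>)
  case Nil
  then show ?case by (auto dest: entails_all_emptyD)
next
  case (Cons B Bs)
  then obtain D \<Delta>' where D: "\<Delta> = D + \<Delta>'" "(\<Gamma>, D) \<tturnstile> Bang B" "entails_all \<Gamma> \<Delta>' (mset (map Bang Bs))"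
    by (auto elim: entails_all_addD)
  then obtain \<Gamma>\<^sub>1 where 1: "taus (\<Gamma>, D) (\<Gamma>\<^sub>1, {#})" "(\<Gamma>\<^sub>1, {#}) \<tturnstile> B" by (auto elim: entails_Bang)
  have "entails_all \<Gamma>\<^sub>1 \<Delta>' (mset (map Bang Bs))"
    using entails_all_mono[OF D(3)] taus_persistent_mono[OF 1(1)] by simp
  then obtain \<Gamma>' where 2: "taus (\<Gamma>\<^sub>1, \<Delta>') (\<Gamma>', {#})" "\<forall>B\<in>set Bs. (\<Gamma>', {#}) \<tturnstile> B"
    using Cons.IH by blast
  have "taus (\<Gamma>, \<Delta>) (\<Gamma>', {#})" using taus_add[OF 1(1), of \<Delta>'] 2(1) D(1) by simp
  moreover have "(\<Gamma>', {#}) \<tturnstile> B" using 1(2) taus_persistent_mono[OF 2(1)] by (auto intro: entails_mono)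
  ultimately show ?case using 2(2) by auto
qed

lemma entails_all_identity: "entails_all \<Gamma> \<Delta> \<Delta>"
proof (induction \<Delta>)
  case (add A \<Delta>)
  then show ?case using entails_all.add[OF entails_identity[of \<Gamma> A]] by simp
qed (rule entails_all.empty)

lemma entails_persistent_Bang: "B |\<in>| \<Gamma> \<Longrightarrow> (\<Gamma>, {#}) \<tturnstile> Bang B"
  using step_copy[of B \<Gamma> "{#}"] by (intro entails.bang entails.tau[OF _ entails_identity])

text \<open>One test formula describes the whole state: the tensor of its linear formulas and of
  \<open>Bang B\<close> for its persistent B. The state entails it, hence so does
  \<open>S\<^sub>2\<close>, and inverting that entailment yields the covering.\<close>

lemma covers_if_entails_imp:
  assumes "\<And>C. (\<Gamma>\<^sub>1, \<Delta>\<^sub>1) \<tturnstile> C \<Longrightarrow> S\<^sub>2 \<tturnstile> C"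
  shows "covers (\<Gamma>\<^sub>1, \<Delta>\<^sub>1) S\<^sub>2"
proof -
  obtain As where As: "mset As = \<Delta>\<^sub>1" by (metis ex_mset)
  obtain Bs where Bs: "set Bs = fset \<Gamma>\<^sub>1" by (metis finite_fset finite_list)
  \<comment> \<open>Stated for any list of persistent formulas to allow induction; each
    \<open>Bang B\<close> takes an empty piece.\<close>
  have "entails_all \<Gamma>\<^sub>1 \<Delta>\<^sub>1 (mset (map Bang Bs' @ As))" if "set Bs' \<subseteq> fset \<Gamma>\<^sub>1" for Bs'
    using that
  proof (induction Bs')
    case Nil
    then show ?case by (simp add: As entails_all_identity)
  next
    case (Cons B Bs')
    then show ?case using entails_all.add[OF entails_persistent_Bang, of B \<Gamma>\<^sub>1] by auto
  qed
  then have "S\<^sub>2 \<tturnstile> tensor_list (map Bang Bs @ As)"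
    using assms entails_tensor_list Bs by blast
  then obtain \<Gamma> \<Delta> where 1: "taus S\<^sub>2 (\<Gamma>, \<Delta>)" "entails_all \<Gamma> \<Delta> (mset (map Bang Bs) + \<Delta>\<^sub>1)"
    using tensor_list_entails_all As by fastforce
  from 1(2) obtain \<Delta>\<^sub>B \<Delta>\<^sub>A where 2: "\<Delta> = \<Delta>\<^sub>B + \<Delta>\<^sub>A" "entails_all \<Gamma> \<Delta>\<^sub>B (mset (map Bang Bs))"
    "entails_all \<Gamma> \<Delta>\<^sub>A \<Delta>\<^sub>1"
    by (rule entails_all_unionD)
  from entails_all_Bang[OF 2(2)] obtain \<Gamma>'
    where 3: "taus (\<Gamma>, \<Delta>\<^sub>B) (\<Gamma>', {#})" "\<forall>B\<in>set Bs. (\<Gamma>', {#}) \<tturnstile> B" by blast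
  \<comment> \<open>The pieces of the \<open>Bang\<close> formulas vanish, leaving those of
    \<open>\<Delta>\<^sub>1\<close>.\<close>
  have "taus S\<^sub>2 (\<Gamma>', \<Delta>\<^sub>A)" using 1(1) taus_add[OF 3(1), of \<Delta>\<^sub>A] 2(1) by simp
  moreover have "entails_all \<Gamma>' \<Delta>\<^sub>A \<Delta>\<^sub>1"
    using entails_all_mono[OF 2(3)] taus_persistent_mono[OF 3(1)] by simp
  ultimately show ?thesis using 3(2) Bs by (auto simp: covers_def)
qed

theorem theorem5:
  fixes \<Gamma>\<^sub>1 \<Gamma>\<^sub>2 :: "'a form fset" and \<Delta>\<^sub>1 \<Delta>\<^sub>2 :: "'a form multiset"
  shows "(mset_set (fset \<Gamma>\<^sub>1), \<Delta>\<^sub>1) \<preceq>\<^sub>l (mset_set (fset \<Gamma>\<^sub>2), \<Delta>\<^sub>2)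
    \<longleftrightarrow> (\<Gamma>\<^sub>1, \<Delta>\<^sub>1) \<preceq>\<^sub>s (\<Gamma>\<^sub>2, \<Delta>\<^sub>2)"
proof
  assume "(mset_set (fset \<Gamma>\<^sub>1), \<Delta>\<^sub>1) \<preceq>\<^sub>l (mset_set (fset \<Gamma>\<^sub>2), \<Delta>\<^sub>2)"
  \<comment> \<open>With the empty context the preorder reads as inclusion of entailed
    formulas.\<close>
  note le = this[unfolded logical_le_iff_entails, rule_format, of "({||}, {#})"]
  have "covers (\<Gamma>\<^sub>1, \<Delta>\<^sub>1) (\<Gamma>\<^sub>2, \<Delta>\<^sub>2)" by (rule covers_if_entails_imp) (use le in simp)
  then show "(\<Gamma>\<^sub>1, \<Delta>\<^sub>1) \<preceq>\<^sub>s (\<Gamma>\<^sub>2, \<Delta>\<^sub>2)" by (rule sim_leI[OF simulation_covers])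
next
  assume "(\<Gamma>\<^sub>1, \<Delta>\<^sub>1) \<preceq>\<^sub>s (\<Gamma>\<^sub>2, \<Delta>\<^sub>2)"
  then show "(mset_set (fset \<Gamma>\<^sub>1), \<Delta>\<^sub>1) \<preceq>\<^sub>l (mset_set (fset \<Gamma>\<^sub>2), \<Delta>\<^sub>2)"
    \<comment> \<open>\<open>sim_le_compose\<close> puts the common context on the right, hence the
      commuted compositions.\<close>
    unfolding logical_le_iff_entails compose_commute[of _ "(\<Gamma>\<^sub>1, \<Delta>\<^sub>1)"]
      compose_commute[of _ "(\<Gamma>\<^sub>2, \<Delta>\<^sub>2)"]
    by (intro allI impI) (rule sim_le_entails[OF _ sim_le_compose])
qed

end
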